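(* Let $f:\mathbb T^2\to(0,\infty)$ be essentially bounded and lower semicontinuous, and let $\Lambda$ be a convex polygon as in the context. For every vertex $A$ of $\Lambda$ there exists a cone $C\subset\mathcal C_{A,0}$ with vertex $O$ for which there is a minimal factorization of $f$ issued from a factorization of $f$ associated with $(\Lambda,A,C)$.
   Context: $\mathbb T^2$ is the torus; $\operatorname{Spec}(g)=\{k\in\mathbb Z^2:\hat g(k)\ne0\}$ is the set of nonzero Fourier indices of $g$. Polygon. Let $\widetilde\Lambda\subset\mathbb R^2$ be a convex polygon with vertices $A_1,\dots,A_m$ (indices mod $m$) with coordinates in $\mathbb N$, and $\Lambda=\widetilde\Lambda\cap\mathbb Z^2$. Let $d_i$ be the line through $A_i,A_{i+1}$, $\tilde S_i^+$ the closed half-plane bounded by $d_i$ containing $\widetilde\Lambda$, and $S_{i,0}^+$ the set of integer points of the translate of $\tilde S_i^+$ by the vector $\overrightarrow{A_iO}$, $O=(0,0)$. For a vertex $A=A_i$, $\mathcal C_{A}$ is the two-sided cone with vertex $A$ bounded by $d_{i-1}$ and $d_i$, $\mathcal C_A^+$ its half-cone containing $\widetilde\Lambda$, and $\mathcal C_{A,0},\mathcal C_{A,0}^+$ their translates with vertex $O$. Factorization associated with $(\Lambda,A,C)$. Let $C\subset\mathcal C_{A,0}$ be a two-sided cone with vertex $O$ (not reduced to a line), with half-cone $C^+\subset\mathcal C_{A,0}^+$, and let $f=\alpha\bar\alpha$ with $\alpha\in L^\infty(\mathbb T^2)$, $\operatorname{Spec}(\alpha)\subset C^+$. A factorization of $f$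 associated with $(\Lambda,A,C)$ is an $m$-tuple $(G_1,\dots,G_m)$ such that for every $i$: $f=G_i\overline{G_i}$, $G_i^{\pm1}\in L^\infty(\mathbb T^2)$, $\operatorname{Spec}(G_i)\subset S_{i,0}^+$ and $G_i\in\{\alpha,\bar\alpha\}$. Minimal factorization. Given such an $m$-tuple, group the side indices (cyclically, i.e. after a suitable cyclic renumbering of the sides) into $p\ge2$ maximal blocks $I_1,\dots,I_p$ of consecutive indices on which $G_k$ is constant, equal to $g_i$ on $I_i$, with $g_i\neq g_{i+1}$ (and $g_{p+1}=g_1$). The $p$-tuple $(g_1,\dots,g_p)$ is the factorization issued from $(G_1,\dots,G_m)$; it is called minimal if $p=2$. *)

theory Defs
  imports "HOL-Analysis.Analysis"
begin

definition torus :: "(complex \<times> complex) set" where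
  "torus = sphere 0 1 \<times> sphere 0 1"

text \<open>Normalized Haar measure: the image of Lebesgue measure on the unit square under
  the parametrization by angles.\<close>

definition haar :: "(complex \<times> complex) measure" where
  "haar = distr (restrict_space lborel ({0..1} \<times> {0..1})) (restrict_space borel torus)
     (\<lambda>(s, t). (cis (2 * pi * s), cis (2 * pi * t)))"

definition ess_bounded :: "'a measure \<Rightarrow> ('a \<Rightarrow> 'b::real_normed_vector) \<Rightarrow> bool" where
  "ess_bounded M g \<longleftrightarrow> (\<exists>B. AE x in M. norm (g x) \<le> B)"

definition Linf :: "'a measure \<Rightarrow> ('a \<Rightarrow> complex) set" where
  "Linf M = {g \<in> borel_measurable M. ess_bounded M g}"

text \<open>Elements of \<open>Linf M\<close> are representatives; equality in the space of classes is
  equality almost everywhere.\<close>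

definition ae_eq :: "'a measure \<Rightarrow> ('a \<Rightarrow> 'b) \<Rightarrow> ('a \<Rightarrow> 'b) \<Rightarrow> bool" where
  "ae_eq M g h \<longleftrightarrow> (AE x in M. g x = h x)"

text \<open>Both \<open>g\<close> and its reciprocal are essentially bounded. The middle conjunct is needed
  because \<open>inverse 0 = 0\<close>.\<close>

definition Linf_invertible :: "'a measure \<Rightarrow> ('a \<Rightarrow> complex) \<Rightarrow> bool" where
  "Linf_invertible M g \<longleftrightarrow>
     g \<in> Linf M \<and> (AE x in M. g x \<noteq> 0) \<and> (\<lambda>x. inverse (g x)) \<in> Linf M"

definition lower_semicontinuous_on ::
    "'a::topological_space set \<Rightarrow> ('a \<Rightarrow> real) \<Rightarrow> bool" where
  "lower_semicontinuous_on S f \<longleftrightarrow>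
     (\<forall>x\<in>S. \<forall>c<f x. eventually (\<lambda>y. c < f y) (at x within S))"

definition fourier_coeff :: "(complex \<times> complex \<Rightarrow> complex) \<Rightarrow> int \<times> int \<Rightarrow> complex" where
  "fourier_coeff g k =
     (LINT z|haar. g z * (fst z powi (- fst k) * snd z powi (- snd k)))"

definition Spec :: "(complex \<times> complex \<Rightarrow> complex) \<Rightarrow> (int \<times> int) set" where
  "Spec g = {k. fourier_coeff g k \<noteq> 0}"

definition lattice_pt :: "int \<times> int \<Rightarrow> real \<times> real" where
  "lattice_pt k = (of_int (fst k), of_int (snd k))"

definition integer_points :: "(real \<times> real) set \<Rightarrow> (int \<times> int) set" where
  "integer_points X = {k. lattice_pt k \<in> X}"

text \<open>A polygon is given by the list of its vertices; positions are read modulo the length.\<close>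

definition vertex :: "(nat \<times> nat) list \<Rightarrow> nat \<Rightarrow> real \<times> real" where
  "vertex As i = (let A = As ! (i mod length As) in (real (fst A), real (snd A)))"

definition polygon :: "(nat \<times> nat) list \<Rightarrow> (real \<times> real) set" where
  "polygon As = convex hull (vertex As ` {..<length As})"

text \<open>The entries of \<open>As\<close> are exactly the vertices (extreme points) of the polygon, listed
  without repetition in cyclic order along the boundary (in either direction).\<close>

definition convex_polygon :: "(nat \<times> nat) list \<Rightarrow> bool" where
  "convex_polygon As \<longleftrightarrow>
     3 \<le> length As \<and> distinct As \<and>
     (\<forall>i<length As. vertex As i extreme_point_of polygon As) \<and>
     (\<forall>i<length As. closed_segment (vertex As i) (vertex As (Suc i)) edge_of polygon As)"

definition side_line :: "(nat \<times> nat) list \<Rightarrow> nat \<Rightarrow> (real \<times> real) set" where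
  "side_line As i = affine hull {vertex As i, vertex As (Suc i)}"

definition closed_half_plane_bounded_by ::
    "(real \<times> real) set \<Rightarrow> (real \<times> real) set \<Rightarrow> bool" where
  "closed_half_plane_bounded_by d H \<longleftrightarrow>
     (\<exists>a b. a \<noteq> 0 \<and> d = {x. a \<bullet> x = b} \<and> H = {x. a \<bullet> x \<le> b})"

text \<open>For a convex polygon the half-plane below exists, because the side is an edge, and is
  unique, because the polygon is not contained in a line.\<close>

definition side_half_plane :: "(nat \<times> nat) list \<Rightarrow> nat \<Rightarrow> (real \<times> real) set" where
  "side_half_plane As i =
     (THE H. closed_half_plane_bounded_by (side_line As i) H \<and> polygon As \<subseteq> H)"

definition side_points0 :: "(nat \<times> nat) list \<Rightarrow> nat \<Rightarrow> (int \<times> int) set" where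
  "side_points0 As i =
     integer_points ((\<lambda>x. x - vertex As i) ` side_half_plane As i)"

text \<open>The half-cone at vertex \<open>i\<close> containing the polygon and bounded by the lines of the two
  sides meeting there; the preceding side has index \<open>i - 1\<close> modulo the length. The suffix
  \<open>0\<close> marks translates by the vector from vertex \<open>i\<close> to the origin.\<close>

definition vertex_half_cone :: "(nat \<times> nat) list \<Rightarrow> nat \<Rightarrow> (real \<times> real) set" where
  "vertex_half_cone As i =
     side_half_plane As (i + length As - 1) \<inter> side_half_plane As i"

definition vertex_half_cone0 :: "(nat \<times> nat) list \<Rightarrow> nat \<Rightarrow> (real \<times> real) set" where
  "vertex_half_cone0 As i = (\<lambda>x. x - vertex As i) ` vertex_half_cone As i"

definition vertex_cone0 :: "(nat \<times> nat) list \<Rightarrow> nat \<Rightarrow> (real \<times> real) set" where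
  "vertex_cone0 As i = vertex_half_cone0 As i \<union> uminus ` vertex_half_cone0 As i"

text \<open>Linear independence of the generators expresses that the cone is not reduced to a line.
  The half-cone of a two-sided cone is determined up to sign.\<close>

definition half_cone_of :: "(real \<times> real) set \<Rightarrow> (real \<times> real) set \<Rightarrow> bool" where
  "half_cone_of Cp C \<longleftrightarrow>
     (\<exists>u v. u \<noteq> v \<and> independent {u, v} \<and>
        Cp = {s *\<^sub>R u + t *\<^sub>R v | s t. 0 \<le> s \<and> 0 \<le> t}) \<and>
     C = Cp \<union> uminus ` Cp"

definition two_sided_cone :: "(real \<times> real) set \<Rightarrow> bool" where
  "two_sided_cone C \<longleftrightarrow> (\<exists>Cp. half_cone_of Cp C)"

definition abs_square_factor ::
    "(complex \<times> complex \<Rightarrow> real) \<Rightarrow> (complex \<times> complex \<Rightarrow> complex) \<Rightarrow> bool" where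
  "abs_square_factor f g \<longleftrightarrow> ae_eq haar (\<lambda>z. complex_of_real (f z)) (\<lambda>z. g z * cnj (g z))"

definition associated_factorization ::
    "(nat \<times> nat) list \<Rightarrow> nat \<Rightarrow> (real \<times> real) set \<Rightarrow> (complex \<times> complex \<Rightarrow> real) \<Rightarrow>
     (complex \<times> complex \<Rightarrow> complex) list \<Rightarrow> bool" where
  "associated_factorization As j C f Gs \<longleftrightarrow>
     C \<subseteq> vertex_cone0 As j \<and>
     (\<exists>Cp \<alpha>. half_cone_of Cp C \<and> Cp \<subseteq> vertex_half_cone0 As j \<and>
        \<alpha> \<in> Linf haar \<and> abs_square_factor f \<alpha> \<and> Spec \<alpha> \<subseteq> integer_points Cp \<and>
        length Gs = length As \<and>
        (\<forall>i<length As.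
           abs_square_factor f (Gs ! i) \<and>
           Linf_invertible haar (Gs ! i) \<and>
           Spec (Gs ! i) \<subseteq> side_points0 As i \<and>
           (ae_eq haar (Gs ! i) \<alpha> \<or> ae_eq haar (Gs ! i) (\<lambda>z. cnj (\<alpha> z)))))"

text \<open>After the cyclic renumbering by \<open>r\<close>, the \<open>j\<close>-th block consists of the positions
  \<open>b j, \<dots>, b (Suc j) - 1\<close>. Maximality of the blocks is the last conjunct.\<close>

definition issued_factorization ::
    "(complex \<times> complex \<Rightarrow> complex) list \<Rightarrow> (complex \<times> complex \<Rightarrow> complex) list \<Rightarrow> bool" where
  "issued_factorization Gs gs \<longleftrightarrow>
     2 \<le> length gs \<and>
     (\<exists>r b. b 0 = 0 \<and> b (length gs) = length Gs \<and>
        (\<forall>j<length gs. b j < b (Suc j) \<and>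
           (\<forall>k\<in>{b j..<b (Suc j)}. ae_eq haar (Gs ! ((r + k) mod length Gs)) (gs ! j)))) \<and>
     (\<forall>j<length gs. \<not> ae_eq haar (gs ! j) (gs ! (Suc j mod length gs)))"

definition minimal_factorization :: "(complex \<times> complex \<Rightarrow> complex) list \<Rightarrow> bool" where
  "minimal_factorization gs \<longleftrightarrow> length gs = 2"

end

theory Submission
  imports Defs
begin

text \<open>Put \<open>h = ln f / 2\<close> and choose a half-cone inside the cone at the vertex so thin that no side is
  parallel to a direction in it. A bounded function \<open>\<alpha>\<close> with \<open>\<bar>\<alpha>\<bar> = e\<^sup>h\<close> and spectrum in this half-cone
  is obtained as in Rudin's theorem on moduli of bounded analytic functions on the polydisc. If \<open>p \<ge> 0\<close>
  is a trigonometric polynomial and \<open>w = z\<^sup>K\<close> with \<open>K\<close> deep inside the half-cone, then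
  \<open>a\<^sub>p = exp (- 2 p w / (1 - w))\<close> has spectrum in the half-cone, constant term 1 and modulus \<open>e\<^sup>p\<close> almost
  everywhere, so that \<open>\<integral> \<bar>a\<^sub>p - 1\<bar>\<^sup>2 = \<integral> (e\<^sup>2\<^sup>p - 1)\<close> is of the order of \<open>\<integral> p\<close>. As \<open>h\<close> is
  lower semicontinuous, it is up to a constant a sum of such \<open>p\<close> whose integrals decay geometrically,
  and the product of the factors \<open>a\<^sub>p\<close> converges almost everywhere.

  Every side then has the half-cone or its negative on the inner side, which decides between \<open>\<alpha>\<close> and its
  conjugate. The choice changes only twice around the polygon because a linear functional that is
  constant on no side has a single local minimum among the vertices. If \<open>\<alpha>\<close> happens to be real, it
  is replaced by \<open>\<i> \<alpha>\<close>.\<close>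

section \<open>Haar measure and characters of the torus\<close>

text \<open>In one variable one would exponentiate h plus \<i> times its conjugate function. Here
  this fails: the real part of a function with spectrum in a pointed half-cone has its spectrum in
  the half-cone and its negative, and h need not be of this kind. The function w / (1 - w) is the
  way around: on the circle its real part is the constant -1/2, yet formally all its frequencies are
  positive multiples of K. Multiplying by p therefore prescribes the real part freely while the
  finitely many frequencies of p are pushed into the half-cone. The price is the singularity at w =
  1. It is approached through r w with r < 1, and p >= 0 keeps the exponentials bounded there; this
  is why h has to be an increasing limit, and where lower semicontinuity enters. Nothing is known
  about the phase of \<open>a_p\<close>; the estimate of its distance to 1 uses only modulus and
  mean, and the mean is accessible because a pointed cone isolates the frequency 0.\<close>

lemma space_haar [simp]: "space haar = torus"
  by (simp add: haar_def space_restrict_space)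

lemma sets_haar: "sets haar = sets (restrict_space borel torus)"
  by (simp add: haar_def)

definition angles :: "real \<times> real \<Rightarrow> complex \<times> complex" where
  "angles = (\<lambda>(s, t). (cis (2 * pi * s), cis (2 * pi * t)))"

lemma angles_measurable:
  "angles \<in> measurable (restrict_space lborel ({0..1} \<times> {0..1})) (restrict_space borel torus)"
proof -
  have "continuous_on UNIV angles"
    unfolding angles_def case_prod_beta by (intro continuous_intros)
  then have "angles \<in> borel_measurable lborel"
    by (simp add: borel_measurable_continuous_onI)
  then show ?thesis
    by (intro measurable_restrict_space2 measurable_restrict_space1)
      (auto simp: angles_def torus_def space_restrict_space)
qed

lemma haar_eq: "haar = distr (restrict_space lborel ({0..1} \<times> {0..1})) (restrict_space borel torus) angles"
  by (simp add: haar_def angles_def)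

lemma square_in_sets: "{0..1::real} \<times> {0..1::real} \<in> sets borel"
  using borel_closed[OF closed_Times[of "{0..1::real}" "{0..1::real}"]] by simp

lemma emeasure_haar: "emeasure haar torus = 1"
proof -
  let ?S = "{0..1::real} \<times> {0..1::real}"
  have "emeasure haar torus = emeasure (restrict_space lborel ?S) (angles -` torus \<inter> space (restrict_space lborel ?S))"
    unfolding haar_eq
    by (intro emeasure_distr angles_measurable) (auto simp: sets_restrict_space)
  also have "angles -` torus \<inter> space (restrict_space lborel ?S) = ?S"
    by (auto simp: angles_def torus_def space_restrict_space)
  also have "emeasure (restrict_space lborel ?S) ?S = emeasure lborel ?S"
    by (intro emeasure_restrict_space) (auto simp: square_in_sets)
  also have "\<dots> = emeasure (lborel \<Otimes>\<^sub>M lborel) ?S"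
    by (simp add: lborel_prod)
  also have "\<dots> = 1"
    by (subst lborel.emeasure_pair_measure_Times) auto
  finally show ?thesis .
qed

interpretation haar: finite_measure haar
  by standard (simp add: emeasure_haar)

lemma measure_haar [simp]: "measure haar torus = 1"
  by (simp add: measure_def emeasure_haar)

definition character :: "int \<times> int \<Rightarrow> complex \<times> complex \<Rightarrow> complex" where
  "character k z = fst z powi fst k * snd z powi snd k"

lemma fst_measurable_haar [measurable]: "fst \<in> borel_measurable haar"
  and snd_measurable_haar [measurable]: "snd \<in> borel_measurable haar"
  unfolding measurable_cong_sets[OF sets_haar refl]
  by (intro measurable_restrict_space1 borel_measurable_continuous_onI continuous_intros)+

lemma character_measurable [measurable]: "character k \<in> borel_measurable haar"
  unfolding character_def power_int_def by measurable

lemma torus_nz: "z \<in> torus \<Longrightarrow> fst z \<noteq> 0 \<and> snd z \<noteq> 0"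
  by (auto simp: torus_def)

lemma norm_character: "z \<in> torus \<Longrightarrow> norm (character k z) = 1"
  by (auto simp: torus_def character_def norm_mult norm_power_int)

lemma character_add: "z \<in> torus \<Longrightarrow> character (k + l) z = character k z * character l z"
  using torus_nz[of z] by (simp add: character_def power_int_add)

lemma character_0 [simp]: "character 0 z = 1"
  by (simp add: character_def)

lemma fourier_coeff_character: "fourier_coeff g k = (LINT z|haar. g z * character (- k) z)"
  by (simp add: fourier_coeff_def character_def)

lemma integral_cis_period:
  fixes k :: int
  assumes "k \<noteq> 0"
  shows "(LINT s|lborel. indicator {0..1} s *\<^sub>R cis (2 * pi * s) powi k) = 0"
proof -
  let ?F = "\<lambda>s. cis (2 * pi * k * s) / (2 * pi * k * \<i>)"
  have "(LINT s|lborel. indicator {0..1} s *\<^sub>R cis (2 * pi * k * s)) = ?F 1 - ?F 0"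
  proof (rule integral_FTC_Icc)
    show "(?F has_vector_derivative cis (2 * pi * real_of_int k * x)) (at x within {0..1})" for x
      unfolding cis_conv_exp using assms
      by (auto intro!: derivative_eq_intros has_vector_derivative_real_field simp: field_simps)
    show "continuous_on {0..1} (\<lambda>x. cis (2 * pi * real_of_int k * x))"
      by (intro continuous_intros)
  qed simp
  also have "\<dots> = 0"
    using cis_multiple_2pi[of "of_int k"] by (simp)
  finally show ?thesis
    by (simp add: cis_power_int mult.commute mult.left_commute)
qed

text \<open>Fubini splits the integral into two one-dimensional ones, and a nonzero frequency has a
  nonzero component, whose factor vanishes.\<close>

lemma integral_character:
  assumes "k \<noteq> 0"
  shows "(LINT z|haar. character k z) = 0"
proof -
  let ?S = "{0..1::real} \<times> {0..1::real}"
  let ?g = "\<lambda>k s. indicator {0..1::real} s *\<^sub>R cis (2 * pi * s) powi k"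
  have i: "integrable lborel (?g k)" for k
    by (intro borel_integrable_compact) (auto intro!: continuous_intros)
  have [measurable]: "?g k \<in> borel_measurable lborel" for k
    using i by (rule borel_measurable_integrable)
  let ?G = "\<lambda>x. ?g (fst k) (fst x) * ?g (snd k) (snd x)"
  have int: "integrable (lborel \<Otimes>\<^sub>M lborel) ?G"
  proof (rule lborel_pair.Fubini_integrable)
    show "?G \<in> borel_measurable (lborel \<Otimes>\<^sub>M lborel)"
      by measurable
    show "integrable lborel (\<lambda>s. LINT t|lborel. norm (?G (s, t)))"
      using integrable_norm[OF i[of "fst k"]]
      by (simp only: norm_mult fst_conv snd_conv integral_mult_right_zero integrable_mult_left)
    show "AE s in lborel. integrable lborel (\<lambda>t. ?G (s, t))"
      using i[of "snd k"] by (intro AE_I2) (simp only: fst_conv snd_conv integrable_mult_right)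
  qed
  have "(LINT z|haar. character k z) = (LINT x|restrict_space lborel ?S. character k (angles x))"
    unfolding haar_eq using character_measurable[of k]
    by (intro integral_distr angles_measurable) (simp add: measurable_cong_sets[OF sets_haar refl])
  also have "\<dots> = (LINT x|lborel. indicator ?S x *\<^sub>R character k (angles x))"
    using integral_restrict_space[of ?S lborel] square_in_sets by simp
  also have "\<dots> = (LINT x|(lborel \<Otimes>\<^sub>M lborel). ?g (fst k) (fst x) * ?g (snd k) (snd x))"
    unfolding lborel_prod
    by (intro Bochner_Integration.integral_cong) (auto simp: character_def angles_def indicator_def)
  also have "\<dots> = (LINT s|lborel. LINT t|lborel. ?g (fst k) s * ?g (snd k) t)"
    using lborel_pair.integral_fst'[OF int] by (simp only: fst_conv snd_conv)
  also have "\<dots> = (LINT s|lborel. ?g (fst k) s) * (LINT t|lborel. ?g (snd k) t)"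
    by (simp only: integral_mult_right_zero integral_mult_left_zero)
  also have "\<dots> = 0"
    using assms integral_cis_period[of "fst k"] integral_cis_period[of "snd k"]
    by (cases k) (auto simp: zero_prod_def)
  finally show ?thesis .
qed

section \<open>Spectra of essentially bounded functions\<close>

lemma Linf_measurable: "g \<in> Linf haar \<Longrightarrow> g \<in> borel_measurable haar"
  by (simp add: Linf_def)

lemma LinfI:
  assumes "g \<in> borel_measurable haar" "AE z in haar. norm (g z) \<le> B"
  shows "g \<in> Linf haar"
  using assms by (auto simp: Linf_def ess_bounded_def)

lemma LinfE:
  assumes "g \<in> Linf haar"
  obtains B where "0 \<le> B" "AE z in haar. norm (g z) \<le> B"
proof -
  obtain B where B: "AE z in haar. norm (g z) \<le> B"
    using assms by (auto simp: Linf_def ess_bounded_def)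
  then have "AE z in haar. norm (g z) \<le> max 0 B"
    by eventually_elim auto
  then show ?thesis
    by (intro that[of "max 0 B"]) auto
qed

lemma integrable_Linf:
  assumes "g \<in> Linf haar"
  shows "integrable haar g"
proof -
  obtain B where "AE z in haar. norm (g z) \<le> B"
    using assms by (rule LinfE)
  then show ?thesis
    using assms by (intro haar.integrable_const_bound[of _ B]) (auto simp: Linf_measurable)
qed

lemma Linf_add:
  assumes "g \<in> Linf haar" "h \<in> Linf haar"
  shows "(\<lambda>z. g z + h z) \<in> Linf haar"
proof -
  obtain B where B: "AE z in haar. norm (g z) \<le> B"
    using assms(1) by (rule LinfE)
  obtain C where C: "AE z in haar. norm (h z) \<le> C"
    using assms(2) by (rule LinfE)
  have "AE z in haar. norm (g z + h z) \<le> B + C"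
    using B C by eventually_elim (rule norm_triangle_mono)
  then show ?thesis
    by (rule LinfI[OF borel_measurable_add[OF assms[THEN Linf_measurable]]])
qed

lemma Linf_mult:
  assumes "g \<in> Linf haar" "h \<in> Linf haar"
  shows "(\<lambda>z. g z * h z) \<in> Linf haar"
proof -
  obtain B where B: "0 \<le> B" "AE z in haar. norm (g z) \<le> B"
    using assms(1) by (rule LinfE)
  obtain C where C: "AE z in haar. norm (h z) \<le> C"
    using assms(2) by (rule LinfE)
  have "AE z in haar. norm (g z * h z) \<le> B * C"
    using B(2) C
  proof eventually_elim
    case (elim z)
    then show ?case
      unfolding norm_mult using B(1) by (intro mult_mono) simp_all
  qed
  then show ?thesis
    by (rule LinfI[OF borel_measurable_times[OF assms[THEN Linf_measurable]]])
qed

lemma Linf_const [simp]: "(\<lambda>z. c) \<in> Linf haar"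
  by (intro LinfI[of _ "norm c"]) auto

lemma Linf_cnj:
  assumes "g \<in> Linf haar"
  shows "(\<lambda>z. cnj (g z)) \<in> Linf haar"
proof -
  have "cnj \<in> borel_measurable borel"
    by (intro borel_measurable_continuous_onI continuous_intros)
  from measurable_compose[OF Linf_measurable[OF assms] this] show ?thesis
    using assms by (simp add: Linf_def ess_bounded_def)
qed

lemma Linf_character [simp]: "character k \<in> Linf haar"
  by (intro LinfI[of _ 1] AE_I2) (auto simp: norm_character)

text \<open>Dominated convergence: constants are integrable because the measure is finite, and
  characters have modulus 1. Through it spectral inclusions survive bounded limits almost
  everywhere.\<close>

lemma Linf_bounded_limit:
  assumes u: "\<And>n. u n \<in> Linf haar"
    and B: "\<And>n. AE z in haar. norm (u n z) \<le> B"
    and lim: "AE z in haar. (\<lambda>n. u n z) \<longlonglongrightarrow> v z"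
    and v: "v \<in> borel_measurable haar"
  shows "v \<in> Linf haar" "(\<lambda>n. fourier_coeff (u n) k) \<longlonglongrightarrow> fourier_coeff v k"
proof -
  have "AE z in haar. \<forall>n. norm (u n z) \<le> B"
    using B by (simp add: AE_all_countable)
  then have "AE z in haar. norm (v z) \<le> B"
    using lim
  proof eventually_elim
    case (elim z)
    then show ?case
      by (intro Lim_bounded[OF tendsto_norm]) auto
  qed
  with v show "v \<in> Linf haar"
    by (rule LinfI)
  have meas: "u n \<in> borel_measurable haar" for n
    using u by (rule Linf_measurable)
  show "(\<lambda>n. fourier_coeff (u n) k) \<longlonglongrightarrow> fourier_coeff v k"
    unfolding fourier_coeff_character
  proof (rule integral_dominated_convergence[where w = "\<lambda>_. B"])
    show "AE z in haar. (\<lambda>n. u n z * character (- k) z) \<longlonglongrightarrow> v z * character (- k) z"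
      using lim by eventually_elim (rule tendsto_mult_right)
    show "AE z in haar. norm (u n z * character (- k) z) \<le> B" for n
      using B[of n] AE_space by eventually_elim (auto simp: norm_mult norm_character)
  qed (use v meas in auto)
qed

lemma fourier_coeff_add:
  assumes "g \<in> Linf haar" "h \<in> Linf haar"
  shows "fourier_coeff (\<lambda>z. g z + h z) k = fourier_coeff g k + fourier_coeff h k"
  unfolding fourier_coeff_character distrib_right using assms
  by (intro Bochner_Integration.integral_add integrable_Linf Linf_mult) auto

lemma fourier_coeff_cmult: "fourier_coeff (\<lambda>z. c * g z) k = c * fourier_coeff g k"
  by (simp add: fourier_coeff_character mult.assoc)

lemma fourier_coeff_shift: "fourier_coeff (\<lambda>z. character m z * g z) k = fourier_coeff g (k - m)"
  unfolding fourier_coeff_character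
proof (rule Bochner_Integration.integral_cong)
  fix z assume "z \<in> space haar"
  then show "character m z * g z * character (- k) z = g z * character (- (k - m)) z"
    using character_add[of z m "- k"] by (simp add: mult_ac)
qed simp

lemma fourier_coeff_cnj: "fourier_coeff (\<lambda>z. cnj (g z)) k = cnj (fourier_coeff g (- k))"
proof -
  \<comment> \<open>A unimodular number has its conjugate as inverse, and the inverse of a character
    is the character of the opposite frequency.\<close>
  have c: "cnj (character k z) = character (- k) z" if "z \<in> torus" for z
  proof -
    have "character k z * cnj (character k z) = 1"
      using complex_norm_square[of "character k z"] norm_character[OF that, of k] by simp
    moreover have "character k z * character (- k) z = 1"
      using character_add[OF that, of k "- k"] by simp
    ultimately have "character k z * cnj (character k z) = character k z * character (- k) z"
      by simp
    then show ?thesis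
      using norm_character[OF that, of k] by (auto simp del: mult_cancel_right)
  qed
  show ?thesis
    unfolding fourier_coeff_character Bochner_Integration.integral_cnj[symmetric]
    by (rule Bochner_Integration.integral_cong) (auto simp: c)
qed

lemma fourier_coeff_cong:
  assumes "\<And>z. z \<in> torus \<Longrightarrow> g z = h z"
  shows "fourier_coeff g k = fourier_coeff h k"
  unfolding fourier_coeff_def using assms by (intro Bochner_Integration.integral_cong) auto

lemma Spec_cong:
  assumes "\<And>z. z \<in> torus \<Longrightarrow> g z = h z"
  shows "Spec g = Spec h"
  unfolding Spec_def using fourier_coeff_cong[OF assms] by simp

lemma Spec_const: "Spec (\<lambda>z. c) \<subseteq> {0}"
proof -
  have "fourier_coeff (\<lambda>z. c) k = 0" if "k \<noteq> 0" for k
    using integral_character[of "- k"] that by (simp add: fourier_coeff_character)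
  then show ?thesis
    by (auto simp: Spec_def)
qed

lemma Spec_add:
  assumes "g \<in> Linf haar" "h \<in> Linf haar"
  shows "Spec (\<lambda>z. g z + h z) \<subseteq> Spec g \<union> Spec h"
  using assms by (auto simp: Spec_def fourier_coeff_add)

lemma Spec_cmult: "Spec (\<lambda>z. c * g z) \<subseteq> Spec g"
  by (auto simp: Spec_def fourier_coeff_cmult)

lemma Spec_shift: "Spec (\<lambda>z. character m z * g z) = (+) m ` Spec g"
proof -
  have "k \<in> (+) m ` Spec g \<longleftrightarrow> k - m \<in> Spec g" for k
    by (auto intro!: image_eqI[of _ _ "k - m"])
  then show ?thesis
    by (auto simp: Spec_def fourier_coeff_shift)
qed

lemma Spec_cnj: "Spec (\<lambda>z. cnj (g z)) = uminus ` Spec g"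
proof -
  have "k \<in> uminus ` Spec g \<longleftrightarrow> - k \<in> Spec g" for k
    by (auto intro!: image_eqI[of _ _ "- k"])
  then show ?thesis
    by (auto simp: Spec_def fourier_coeff_cnj)
qed

lemma Spec_bounded_limit:
  assumes "\<And>n. u n \<in> Linf haar" "\<And>n. AE z in haar. norm (u n z) \<le> B"
    and "AE z in haar. (\<lambda>n. u n z) \<longlonglongrightarrow> v z" "v \<in> borel_measurable haar"
    and "\<And>n. Spec (u n) \<subseteq> Q"
  shows "Spec v \<subseteq> Q"
proof -
  have "fourier_coeff v k = 0" if "k \<notin> Q" for k
  proof -
    have "fourier_coeff (u n) k = 0" for n
      using assms(5)[of n] that by (auto simp: Spec_def)
    with Linf_bounded_limit(2)[OF assms(1-4), of k] show ?thesis
      by (simp add: LIMSEQ_const_iff)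
  qed
  then show ?thesis
    by (auto simp: Spec_def)
qed

text \<open>Cesaro means of the powers of the character converge boundedly to the indicator of the
  set where it equals 1.\<close>

lemma AE_character_neq_1:
  assumes "k \<noteq> 0"
  shows "AE z in haar. character k z \<noteq> 1"
proof -
  define s where "s n z = (\<Sum>i<n. character k z ^ i) / of_nat n" for n z
  define v :: "complex \<times> complex \<Rightarrow> complex" where "v z = (if character k z = 1 then 1 else 0)" for z
  have v: "v \<in> borel_measurable haar"
    unfolding v_def by measurable
  have s: "s n \<in> borel_measurable haar" for n
    unfolding s_def by measurable
  have norm_sum: "norm (s n z) \<le> 1" if "z \<in> torus" for n z
  proof -
    have "norm (\<Sum>i<n. character k z ^ i) \<le> (\<Sum>i<n. 1)"
      by (rule sum_norm_le) (simp add: norm_power norm_character[OF that])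
    then show ?thesis
      by (cases "n = 0") (auto simp: s_def norm_divide)
  qed
  have lim: "(\<lambda>n. s n z) \<longlonglongrightarrow> v z" if z: "z \<in> torus" for z
  proof (cases "character k z = 1")
    case True
    have "(\<lambda>n. s n z) \<longlonglongrightarrow> 1"
      by (rule tendsto_eventually, rule eventually_mono[OF eventually_gt_at_top[of 0]])
        (simp add: s_def True)
    then show ?thesis
      using True by (simp add: v_def)
  next
    case False
    have "(\<lambda>n. s n z) \<longlonglongrightarrow> 0"
    proof (rule Lim_null_comparison)
      show "\<forall>\<^sub>F n in sequentially. norm (s n z) \<le> (2 / norm (1 - character k z)) / real n"
      proof (intro always_eventually allI)
        fix n
        have "norm (1 - character k z ^ n) \<le> 1 + 1"
          by (rule norm_triangle_le_diff) (simp add: norm_power norm_character[OF z])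
        then show "norm (s n z) \<le> (2 / norm (1 - character k z)) / real n"
          using False by (auto simp: s_def sum_gp_strict norm_divide norm_mult intro!: divide_right_mono)
      qed
      show "(\<lambda>n. (2 / norm (1 - character k z)) / real n) \<longlonglongrightarrow> 0"
        by (rule lim_const_over_n)
    qed
    then show ?thesis
      using False by (simp add: v_def)
  qed
  have "(\<lambda>n. LINT z|haar. s n z) \<longlonglongrightarrow> (LINT z|haar. v z)"
    by (rule integral_dominated_convergence[where w = "\<lambda>_. 1"])
      (use v s lim norm_sum in auto)
  \<comment> \<open>Only the power with i = 0 has a nonzero integral. For n = 0 both sides are 0, by
    the convention on division by zero.\<close>
  moreover have "(LINT z|haar. s n z) = 1 / of_nat n" for n
  proof -
    have "(LINT z|haar. character k z ^ i) = (if i = 0 then 1 else 0)" for i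
    proof -
      let ?l = "(int i * fst k, int i * snd k)"
      have *: "character k z ^ i = character ?l z" for z
        unfolding character_def fst_conv snd_conv power_mult_distrib
        by (simp add: power_int_mult mult.commute[of "int i"])
      have "?l \<noteq> 0" if "i \<noteq> 0"
        using assms that by (cases k) (simp add: zero_prod_def)
      then show ?thesis
        unfolding * using integral_character[of ?l] by (cases "i = 0") (simp_all flip: zero_prod_def)
    qed
    moreover have "integrable haar (\<lambda>z. character k z ^ i)" for i
      by (intro integrable_Linf LinfI[of _ 1] AE_I2 borel_measurable_power character_measurable)
        (simp add: norm_power norm_character)
    ultimately show ?thesis
      by (cases "n = 0") (simp_all add: s_def)
  qed
  ultimately have "(LINT z|haar. v z) = 0"
    using LIMSEQ_unique lim_const_over_n[of "1::complex"] by auto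
  moreover have "(LINT z|haar. v z) = complex_of_real (LINT z|haar. norm (v z))"
    unfolding integral_complex_of_real[symmetric]
    by (rule Bochner_Integration.integral_cong) (simp_all add: v_def)
  ultimately have "(LINT z|haar. norm (v z)) = 0"
    by simp
  moreover have "integrable haar (\<lambda>z. norm (v z))"
    by (intro integrable_norm integrable_Linf LinfI[of _ 1]) (use v in \<open>auto simp: v_def\<close>)
  ultimately have "AE z in haar. norm (v z) = 0"
    using integral_nonneg_eq_0_iff_AE[of haar "\<lambda>z. norm (v z)"] by simp
  then show ?thesis
    by eventually_elim (auto simp: v_def split: if_splits)
qed

section \<open>Multipliers\<close>

definition analytic_Linf :: "(int \<times> int) set \<Rightarrow> (complex \<times> complex \<Rightarrow> complex) set" where
  "analytic_Linf Q = {g \<in> Linf haar. Spec g \<subseteq> Q}"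

text \<open>Unlike the functions with spectrum in a semigroup, multipliers are trivially closed under
  products; bounded limits stay available.\<close>

definition multiplier :: "(int \<times> int) set \<Rightarrow> (int \<times> int) set \<Rightarrow> (complex \<times> complex \<Rightarrow> complex) set" where
  "multiplier P Q = {b \<in> Linf haar. \<forall>g\<in>analytic_Linf P. Spec (\<lambda>z. b z * g z) \<subseteq> Q}"

lemma multiplier_Linf: "b \<in> multiplier P Q \<Longrightarrow> b \<in> Linf haar"
  by (simp add: multiplier_def)

lemma multiplier_Spec_mult:
  "b \<in> multiplier P Q \<Longrightarrow> g \<in> Linf haar \<Longrightarrow> Spec g \<subseteq> P \<Longrightarrow> Spec (\<lambda>z. b z * g z) \<subseteq> Q"
  by (simp add: multiplier_def analytic_Linf_def)

lemma multiplierI: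
  assumes "b \<in> Linf haar"
    and "\<And>g. g \<in> Linf haar \<Longrightarrow> Spec g \<subseteq> P \<Longrightarrow> Spec (\<lambda>z. b z * g z) \<subseteq> Q"
  shows "b \<in> multiplier P Q"
  using assms by (simp add: multiplier_def analytic_Linf_def)

lemma multiplier_add:
  assumes b: "b \<in> multiplier P Q" and c: "c \<in> multiplier P Q"
  shows "(\<lambda>z. b z + c z) \<in> multiplier P Q"
proof (rule multiplierI)
  show "(\<lambda>z. b z + c z) \<in> Linf haar"
    using b c by (simp add: Linf_add multiplier_Linf)
next
  fix g assume g: "g \<in> Linf haar" "Spec g \<subseteq> P"
  have "Spec (\<lambda>z. b z * g z + c z * g z) \<subseteq> Spec (\<lambda>z. b z * g z) \<union> Spec (\<lambda>z. c z * g z)"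
    using b c g by (intro Spec_add Linf_mult) (auto intro: multiplier_Linf)
  then show "Spec (\<lambda>z. (b z + c z) * g z) \<subseteq> Q"
    using multiplier_Spec_mult[OF b g] multiplier_Spec_mult[OF c g] by (auto simp: distrib_right)
qed

text \<open>With \<open>Q \<subseteq> P\<close> the output of \<open>c\<close> is again an
  admissible input for \<open>b\<close>; no convolution of Fourier series is involved.\<close>

lemma multiplier_mult:
  assumes b: "b \<in> multiplier P Q" and c: "c \<in> multiplier P Q" and "Q \<subseteq> P"
  shows "(\<lambda>z. b z * c z) \<in> multiplier P Q"
proof (rule multiplierI)
  show "(\<lambda>z. b z * c z) \<in> Linf haar"
    using b c by (simp add: Linf_mult multiplier_Linf)
next
  fix g assume g: "g \<in> Linf haar" "Spec g \<subseteq> P"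
  have "Spec (\<lambda>z. c z * g z) \<subseteq> P"
    using multiplier_Spec_mult[OF c g] \<open>Q \<subseteq> P\<close> by blast
  moreover have "(\<lambda>z. c z * g z) \<in> Linf haar"
    using c g by (simp add: Linf_mult multiplier_Linf)
  ultimately show "Spec (\<lambda>z. b z * c z * g z) \<subseteq> Q"
    using multiplier_Spec_mult[OF b] by (simp add: mult.assoc)
qed

lemma multiplier_zero: "(\<lambda>z. 0) \<in> multiplier P Q"
  by (rule multiplierI) (simp_all add: Spec_def fourier_coeff_def)

lemma multiplier_cmult:
  assumes b: "b \<in> multiplier P Q"
  shows "(\<lambda>z. c * b z) \<in> multiplier P Q"
proof (rule multiplierI)
  show "(\<lambda>z. c * b z) \<in> Linf haar"
    using b by (simp add: Linf_mult multiplier_Linf)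
next
  fix g assume g: "g \<in> Linf haar" "Spec g \<subseteq> P"
  show "Spec (\<lambda>z. c * b z * g z) \<subseteq> Q"
    using multiplier_Spec_mult[OF b g] Spec_cmult[of c "\<lambda>z. b z * g z"] by (auto simp: mult.assoc)
qed

lemma multiplier_sum:
  assumes "\<And>i. i \<in> I \<Longrightarrow> b i \<in> multiplier P Q"
  shows "(\<lambda>z. \<Sum>i\<in>I. b i z) \<in> multiplier P Q"
  using assms
  by (induction I rule: infinite_finite_induct) (auto intro: multiplier_zero multiplier_add)

lemma multiplier_power:
  assumes b: "b \<in> multiplier P Q" and "Q \<subseteq> P"
  shows "(\<lambda>z. b z ^ Suc n) \<in> multiplier P Q"
proof (induction n)
  case 0
  then show ?case using b by simp
next
  case (Suc n)
  show ?case
    using multiplier_mult[OF b Suc \<open>Q \<subseteq> P\<close>] by simp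
qed

text \<open>Multiplication by a fixed bounded \<open>g\<close> preserves bounded convergence almost
  everywhere, so \<open>Spec_bounded_limit\<close> applies to each \<open>g\<close>
  separately.\<close>

lemma multiplier_bounded_limit:
  assumes u: "\<And>n. u n \<in> multiplier P Q"
    and B: "\<And>n. AE z in haar. norm (u n z) \<le> B"
    and lim: "AE z in haar. (\<lambda>n. u n z) \<longlonglongrightarrow> v z"
    and v: "v \<in> borel_measurable haar"
  shows "v \<in> multiplier P Q"
proof (rule multiplierI)
  show "v \<in> Linf haar"
    by (rule Linf_bounded_limit(1)[OF multiplier_Linf[OF u] B lim v])
next
  fix g assume g: "g \<in> Linf haar" "Spec g \<subseteq> P"
  obtain C where C: "0 \<le> C" "AE z in haar. norm (g z) \<le> C"
    using g(1) by (rule LinfE)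
  show "Spec (\<lambda>z. v z * g z) \<subseteq> Q"
  proof (rule Spec_bounded_limit[where u = "\<lambda>n z. u n z * g z" and B = "B * C"])
    show "(\<lambda>z. u n z * g z) \<in> Linf haar" for n
      by (rule Linf_mult[OF multiplier_Linf[OF u] g(1)])
    show "AE z in haar. norm (u n z * g z) \<le> B * C" for n
      using B[of n] C(2)
    proof eventually_elim
      case (elim z)
      then show ?case
        unfolding norm_mult using C(1) order_trans[OF norm_ge_zero elim(1)]
        by (intro mult_mono) simp_all
    qed
    show "AE z in haar. (\<lambda>n. u n z * g z) \<longlonglongrightarrow> v z * g z"
      using lim by eventually_elim (rule tendsto_mult_right)
    show "(\<lambda>z. v z * g z) \<in> borel_measurable haar"
      by (rule borel_measurable_times[OF v Linf_measurable[OF g(1)]])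
    show "Spec (\<lambda>z. u n z * g z) \<subseteq> Q" for n
      by (rule multiplier_Spec_mult[OF u g])
  qed
qed

text \<open>Subtracting 1 leaves only positive powers of \<open>b\<close>, all of which map into
  \<open>Q\<close>. The partial sums are dominated by the scalar series of exp B - 1.\<close>

lemma multiplier_exp:
  assumes b: "b \<in> multiplier P Q" and "Q \<subseteq> P" and B: "AE z in haar. norm (b z) \<le> B"
  shows "(\<lambda>z. exp (b z) - 1) \<in> multiplier P Q"
proof (rule multiplier_bounded_limit)
  let ?u = "\<lambda>n z. \<Sum>i<n. inverse (fact (Suc i)) * b z ^ Suc i"
  show "?u n \<in> multiplier P Q" for n
    by (intro multiplier_sum multiplier_cmult multiplier_power b \<open>Q \<subseteq> P\<close>)
  have sums: "(\<lambda>i. inverse (fact (Suc i)) * x ^ Suc i) sums (exp x - 1)" for x :: "'a::{real_normed_field,banach}"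
  proof -
    have "(\<lambda>i. inverse (fact i) * x ^ i) sums exp x"
      using exp_converges[of x] by (simp add: scaleR_conv_of_real)
    then show ?thesis
      using sums_Suc_iff[of "\<lambda>i. inverse (fact i) * x ^ i" "exp x - 1"] by simp
  qed
  show "AE z in haar. norm (?u n z) \<le> exp B - 1" for n
    using B
  proof eventually_elim
    case (elim z)
    have "norm (?u n z) \<le> (\<Sum>i<n. inverse (fact (Suc i)) * B ^ Suc i)"
    proof (rule sum_norm_le)
      show "norm (inverse (fact (Suc i)) * b z ^ Suc i) \<le> inverse (fact (Suc i)) * B ^ Suc i" for i
        unfolding norm_mult norm_power norm_inverse norm_fact
        by (intro mult_left_mono power_mono elim) simp_all
    qed
    also have "\<dots> \<le> exp B - 1"
      unfolding sums_unique[OF sums] using order_trans[OF norm_ge_zero elim]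
      by (intro sum_le_suminf sums_summable[OF sums]) simp_all
    finally show ?case .
  qed
  show "AE z in haar. (\<lambda>n. ?u n z) \<longlonglongrightarrow> exp (b z) - 1"
    using sums by (intro AE_I2) (simp only: sums_def)
  show "(\<lambda>z. exp (b z) - 1) \<in> borel_measurable haar"
    by (intro borel_measurable_diff measurable_compose[OF Linf_measurable[OF multiplier_Linf[OF b]] borel_measurable_exp]) simp
qed

text \<open>Encodes trigonometric polynomials with frequencies in \<open>F\<close> by their action on spectra, so that no
  coefficients have to be handled.\<close>

definition bandwidth :: "(int \<times> int) set \<Rightarrow> (complex \<times> complex \<Rightarrow> complex) \<Rightarrow> bool" where
  "bandwidth F q \<longleftrightarrow> q \<in> Linf haar \<and>
     (\<forall>g\<in>Linf haar. Spec (\<lambda>z. q z * g z) \<subseteq> {m + k | m k. m \<in> F \<and> k \<in> Spec g})"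

lemma bandwidth_Linf: "bandwidth F q \<Longrightarrow> q \<in> Linf haar"
  by (simp add: bandwidth_def)

lemma bandwidth_character: "bandwidth {m} (character m)"
  unfolding bandwidth_def Spec_shift image_def by (intro conjI ballI Linf_character) blast

lemma bandwidth_add:
  assumes p: "bandwidth F p" and q: "bandwidth G q"
  shows "bandwidth (F \<union> G) (\<lambda>z. p z + q z)"
  unfolding bandwidth_def
proof (intro conjI ballI)
  show "(\<lambda>z. p z + q z) \<in> Linf haar"
    using p q by (simp add: Linf_add bandwidth_Linf)
next
  fix g assume g: "g \<in> Linf haar"
  have "Spec (\<lambda>z. p z * g z + q z * g z) \<subseteq> Spec (\<lambda>z. p z * g z) \<union> Spec (\<lambda>z. q z * g z)"
    using p q g by (intro Spec_add Linf_mult) (auto intro: bandwidth_Linf)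
  then show "Spec (\<lambda>z. (p z + q z) * g z) \<subseteq> {m + k |m k. m \<in> F \<union> G \<and> k \<in> Spec g}"
    using p[unfolded bandwidth_def, THEN conjunct2, rule_format, OF g]
      q[unfolded bandwidth_def, THEN conjunct2, rule_format, OF g]
    unfolding distrib_right by blast
qed

lemma bandwidth_mult:
  assumes p: "bandwidth F p" and q: "bandwidth G q"
  shows "bandwidth {m + k | m k. m \<in> F \<and> k \<in> G} (\<lambda>z. p z * q z)"
  unfolding bandwidth_def
proof (intro conjI ballI)
  show "(\<lambda>z. p z * q z) \<in> Linf haar"
    using p q by (simp add: Linf_mult bandwidth_Linf)
next
  fix g assume g: "g \<in> Linf haar"
  have qg: "(\<lambda>z. q z * g z) \<in> Linf haar"
    using q g by (simp add: Linf_mult bandwidth_Linf)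
  have "Spec (\<lambda>z. p z * (q z * g z)) \<subseteq> {m + k |m k. m \<in> F \<and> k \<in> Spec (\<lambda>z. q z * g z)}"
    by (rule p[unfolded bandwidth_def, THEN conjunct2, rule_format, OF qg])
  also have "\<dots> \<subseteq> {m + (l + k) |m l k. m \<in> F \<and> l \<in> G \<and> k \<in> Spec g}"
    using q[unfolded bandwidth_def, THEN conjunct2, rule_format, OF g] by blast
  also have "\<dots> \<subseteq> {m + k |m k. m \<in> {m + k |m k. m \<in> F \<and> k \<in> G} \<and> k \<in> Spec g}"
    unfolding add.assoc[symmetric] by blast
  finally show "Spec (\<lambda>z. p z * q z * g z) \<subseteq> {m + k |m k. m \<in> {m + k |m k. m \<in> F \<and> k \<in> G} \<and> k \<in> Spec g}"
    unfolding mult.assoc .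
qed

lemma bandwidth_cmult:
  assumes p: "bandwidth F p"
  shows "bandwidth F (\<lambda>z. c * p z)"
  unfolding bandwidth_def
proof (intro conjI ballI)
  show "(\<lambda>z. c * p z) \<in> Linf haar"
    using p by (simp add: Linf_mult bandwidth_Linf)
next
  fix g assume g: "g \<in> Linf haar"
  show "Spec (\<lambda>z. c * p z * g z) \<subseteq> {m + k |m k. m \<in> F \<and> k \<in> Spec g}"
    using p g Spec_cmult[of c "\<lambda>z. p z * g z"] unfolding bandwidth_def mult.assoc by blast
qed

lemma bandwidth_const: "bandwidth {0} (\<lambda>z. c)"
  using bandwidth_cmult[OF bandwidth_character[of 0], of c] by simp

lemma bandwidth_cong:
  assumes p: "bandwidth F p" and eq: "\<And>z. z \<in> torus \<Longrightarrow> q z = p z"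
  shows "bandwidth F q"
  unfolding bandwidth_def
proof (intro conjI ballI)
  have "p \<in> Linf haar"
    by (rule bandwidth_Linf[OF p])
  moreover have "(q \<in> borel_measurable haar) = (p \<in> borel_measurable haar)"
    by (rule measurable_cong) (simp add: eq)
  moreover have "(AE z in haar. norm (q z) \<le> B) = (AE z in haar. norm (p z) \<le> B)" for B
    by (rule AE_cong) (simp add: eq)
  ultimately show "q \<in> Linf haar"
    by (simp add: Linf_def ess_bounded_def)
next
  fix g assume g: "g \<in> Linf haar"
  have "Spec (\<lambda>z. q z * g z) = Spec (\<lambda>z. p z * g z)"
    by (rule Spec_cong) (simp add: eq)
  then show "Spec (\<lambda>z. q z * g z) \<subseteq> {m + k |m k. m \<in> F \<and> k \<in> Spec g}"
    using p g unfolding bandwidth_def by simp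
qed

text \<open>On the torus the inverse of a coordinate is its conjugate, so real and imaginary parts
  combine two opposite characters.\<close>

lemma bandwidth_coordinates:
  shows "\<exists>F. finite F \<and> bandwidth F (\<lambda>z. complex_of_real (Re (fst z)))"
    and "\<exists>F. finite F \<and> bandwidth F (\<lambda>z. complex_of_real (Im (fst z)))"
    and "\<exists>F. finite F \<and> bandwidth F (\<lambda>z. complex_of_real (Re (snd z)))"
    and "\<exists>F. finite F \<and> bandwidth F (\<lambda>z. complex_of_real (Im (snd z)))"
proof -
  have b: "\<exists>F. finite F \<and> bandwidth F q"
    if "\<And>z. z \<in> torus \<Longrightarrow> q z = a * character m z + b * character (- m) z" for q m a b
  proof (intro exI conjI)
    show "bandwidth ({m} \<union> {- m}) q"
      by (rule bandwidth_cong[OF bandwidth_add[OF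
            bandwidth_cmult[OF bandwidth_character] bandwidth_cmult[OF bandwidth_character]] that])
  qed simp
  have cn: "inverse z = cnj z" if "norm z = 1" for z :: complex
    using that complex_norm_square[of z] by (intro inverse_unique) simp
  have re: "complex_of_real (Re z) = 1/2 * z + 1/2 * inverse z" if "norm z = 1" for z
    unfolding cn[OF that] by (simp add: complex_eq_iff)
  have im: "complex_of_real (Im z) = (- \<i>/2) * z + (\<i>/2) * inverse z" if "norm z = 1" for z
    unfolding cn[OF that] by (simp add: complex_eq_iff)
  have ch: "character (1, 0) z = fst z" "character (- (1, 0)) z = inverse (fst z)"
    "character (0, 1) z = snd z" "character (- (0, 1)) z = inverse (snd z)" for z
    by (simp_all add: character_def power_int_minus)
  have norm1: "norm (fst z) = 1" "norm (snd z) = 1" if "z \<in> torus" for z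
    using that by (auto simp: torus_def)
  show "\<exists>F. finite F \<and> bandwidth F (\<lambda>z. complex_of_real (Re (fst z)))"
    by (rule b[where m = "(1, 0)"], unfold ch, rule re, rule norm1)
  show "\<exists>F. finite F \<and> bandwidth F (\<lambda>z. complex_of_real (Im (fst z)))"
    by (rule b[where m = "(1, 0)"], unfold ch, rule im, rule norm1)
  show "\<exists>F. finite F \<and> bandwidth F (\<lambda>z. complex_of_real (Re (snd z)))"
    by (rule b[where m = "(0, 1)"], unfold ch, rule re, rule norm1)
  show "\<exists>F. finite F \<and> bandwidth F (\<lambda>z. complex_of_real (Im (snd z)))"
    by (rule b[where m = "(0, 1)"], unfold ch, rule im, rule norm1)
qed

text \<open>Stone-Weierstrass supplies polynomials in the four real coordinates; on the torus these
  are trigonometric polynomials. The finiteness of \<open>F\<close> is what allows one translation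
  to move all frequencies into a cone.\<close>

lemma bandwidth_real_polynomial_function:
  fixes q :: "complex \<times> complex \<Rightarrow> real"
  assumes "real_polynomial_function q"
  shows "\<exists>F. finite F \<and> bandwidth F (\<lambda>z. complex_of_real (q z))"
  using assms
proof induction
  case (linear f)
  interpret bounded_linear f by fact
  have f: "complex_of_real (f z) =
      (of_real (f (1, 0)) * of_real (Re (fst z)) + of_real (f (\<i>, 0)) * of_real (Im (fst z))) +
      (of_real (f (0, 1)) * of_real (Re (snd z)) + of_real (f (0, \<i>)) * of_real (Im (snd z)))" for z
  proof -
    have "z = Re (fst z) *\<^sub>R (1, 0) + Im (fst z) *\<^sub>R (\<i>, 0) + (Re (snd z) *\<^sub>R (0, 1) + Im (snd z) *\<^sub>R (0, \<i>))"
      by (cases z) (simp add: complex_eq_iff)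
    then have "f z = f (Re (fst z) *\<^sub>R (1, 0) + Im (fst z) *\<^sub>R (\<i>, 0) + (Re (snd z) *\<^sub>R (0, 1) + Im (snd z) *\<^sub>R (0, \<i>)))"
      by (rule arg_cong)
    also have "\<dots> = Re (fst z) * f (1, 0) + Im (fst z) * f (\<i>, 0) + (Re (snd z) * f (0, 1) + Im (snd z) * f (0, \<i>))"
      unfolding add scale by simp
    finally show ?thesis by simp
  qed
  from bandwidth_coordinates obtain F1 F2 F3 F4
    where fin: "finite F1" "finite F2" "finite F3" "finite F4"
    and *: "bandwidth F1 (\<lambda>z. complex_of_real (Re (fst z)))" "bandwidth F2 (\<lambda>z. complex_of_real (Im (fst z)))"
    "bandwidth F3 (\<lambda>z. complex_of_real (Re (snd z)))" "bandwidth F4 (\<lambda>z. complex_of_real (Im (snd z)))"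
    by (elim exE conjE)
  have "bandwidth ((F1 \<union> F2) \<union> (F3 \<union> F4)) (\<lambda>z. complex_of_real (f z))"
    by (rule bandwidth_cong[OF bandwidth_add[OF
          bandwidth_add[OF *(1,2)[THEN bandwidth_cmult]] bandwidth_add[OF *(3,4)[THEN bandwidth_cmult]]] f])
  moreover have "finite ((F1 \<union> F2) \<union> (F3 \<union> F4))"
    using fin by simp
  ultimately show ?case
    by (intro exI conjI)
next
  case (const c)
  show ?case
    using bandwidth_const by (intro exI[of _ "{0}"]) simp
next
  case (add f g)
  then obtain F G where "finite F" "finite G"
    "bandwidth F (\<lambda>z. complex_of_real (f z))" "bandwidth G (\<lambda>z. complex_of_real (g z))"
    by blast
  then show ?case
    using bandwidth_add[of F _ G] by (intro exI[of _ "F \<union> G"]) simp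
next
  case (mult f g)
  then obtain F G where FG: "finite F" "finite G"
    "bandwidth F (\<lambda>z. complex_of_real (f z))" "bandwidth G (\<lambda>z. complex_of_real (g z))"
    by blast
  have "finite {m + k | m k. m \<in> F \<and> k \<in> G}"
    using FG(1,2) by (intro finite_image_set2) simp_all
  then show ?case
    using bandwidth_mult[OF FG(3,4)] by (intro exI[of _ "{m + k | m k. m \<in> F \<and> k \<in> G}"]) simp
qed

section \<open>Exponential factors\<close>

lemma bandwidth_multiplier:
  assumes q: "bandwidth F q" and "\<And>m k. m \<in> F \<Longrightarrow> k \<in> P \<Longrightarrow> m + k \<in> Q"
  shows "q \<in> multiplier P Q"
proof (rule multiplierI[OF bandwidth_Linf[OF q]])
  fix g assume g: "g \<in> Linf haar" "Spec g \<subseteq> P"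
  show "Spec (\<lambda>z. q z * g z) \<subseteq> Q"
    using q[unfolded bandwidth_def, THEN conjunct2, rule_format, OF g(1)] g(2) assms(2) by blast
qed

text \<open>Half of the Poisson kernel minus 1/2, because u / (1 - u) = ((1 + u) / (1 - u) - 1) / 2.
  Hence the value -1/2 on the unit circle and larger values inside.\<close>

lemma Re_geometric:
  assumes "u \<noteq> 1"
  shows "Re (u / (1 - u)) = (1 - (norm u)\<^sup>2) / (2 * (norm (1 - u))\<^sup>2) - 1 / 2"
proof -
  define d where "d = (norm (1 - u))\<^sup>2"
  have d: "d = (1 - Re u)\<^sup>2 + (Im u)\<^sup>2"
    by (simp add: d_def cmod_power2)
  have "d \<noteq> 0"
    using assms by (simp add: d_def)
  have "Re (u / (1 - u)) = (Re u * (1 - Re u) - Im u * Im u) / d"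
    by (simp add: Re_divide d)
  also have "Re u * (1 - Re u) - Im u * Im u = (1 - (norm u)\<^sup>2) / 2 - d / 2"
    unfolding cmod_power2 d by (simp add: power2_eq_square field_simps)
  also have "\<dots> / d = (1 - (norm u)\<^sup>2) / (2 * d) - 1 / 2"
    using \<open>d \<noteq> 0\<close> by (simp add: diff_divide_distrib)
  finally show ?thesis
    by (simp add: d_def)
qed

lemma Re_minus_two_mult: "Re (- 2 * complex_of_real t * x) = - 2 * (t * Re x)"
  by simp

text \<open>Abstracts the lattice points of a half-cone with interior. \<open>deep\<close> moves any
  finite set of frequencies into the cone by a single translation; \<open>pointed\<close> prevents
  nonzero frequencies of the cone from adding up to 0.\<close>

locale deep_cone =
  fixes P :: "(int \<times> int) set"
  assumes zero_mem: "0 \<in> P"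
    and add_mem: "k \<in> P \<Longrightarrow> l \<in> P \<Longrightarrow> k + l \<in> P"
    and pointed: "k \<in> P \<Longrightarrow> - k \<in> P \<Longrightarrow> k = 0"
    and deep: "finite F \<Longrightarrow> \<exists>k. \<forall>m\<in>F. m + k \<in> P - {0}"
begin

abbreviation "P' \<equiv> P - {0}"

text \<open>A vanishing sum would make \<open>l\<close> the negative of \<open>k\<close>, against
  pointedness. So \<open>P'\<close> is an ideal of \<open>P\<close>, and multiplying by frequencies
  in \<open>P'\<close> never recreates a constant term.\<close>

lemma pos_add_mem:
  assumes "k \<in> P'" "l \<in> P"
  shows "k + l \<in> P'"
proof -
  have "l = - k" if "k + l = 0"
    using that by (simp add: eq_neg_iff_add_eq_0 add.commute)
  then have "k + l \<noteq> 0"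
    using assms pointed[of k] by blast
  then show ?thesis
    using assms add_mem by simp
qed

text \<open>The multiplier is tested on the constant 1, whose only frequency 0 lies in
  \<open>P\<close>; the integral is the coefficient at 0, which \<open>P'\<close> omits.\<close>

lemma integral_of_multiplier:
  assumes "b \<in> multiplier P P'"
  shows "(LINT z|haar. b z) = 0"
proof -
  have "Spec (\<lambda>z. b z * 1) \<subseteq> P'"
    using Spec_const[of 1] zero_mem by (intro multiplier_Spec_mult[OF assms] Linf_const) blast
  then have "fourier_coeff b 0 = 0"
    by (auto simp: Spec_def)
  then show ?thesis
    by (simp add: fourier_coeff_character)
qed

text \<open>The exponent is -2 p times the geometric series in r w without its constant term. For r
  < 1 this series converges uniformly, so its partial sums are bounded multipliers. \<open>K\<close>
  is chosen before \<open>r\<close> because the passage r -> 1 needs one \<open>K\<close> for all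
  radii.\<close>

lemma multiplier_Poisson:
  assumes F: "finite F" and p: "bandwidth F (\<lambda>z. complex_of_real (p z))"
    and M: "\<forall>z\<in>torus. 0 \<le> p z \<and> p z \<le> M"
  shows "\<exists>K. K \<noteq> 0 \<and> (\<forall>r. 0 \<le> r \<and> r < 1 \<longrightarrow>
    (\<lambda>z. exp (- 2 * complex_of_real (p z) * (complex_of_real r * character K z / (1 - complex_of_real r * character K z))) - 1) \<in> multiplier P P')"
proof -
  \<comment> \<open>Including 0 puts \<open>K\<close> itself into \<open>P'\<close>; the elements of
    \<open>F\<close> put all frequencies of p w there.\<close>
  obtain K where K: "\<And>m. m \<in> insert 0 F \<Longrightarrow> m + K \<in> P'"
    using deep[of "insert 0 F"] F by blast
  define w where "w = character K"
  have K0: "K \<in> P'"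
    using K[of 0] by simp
  have norm_w: "norm (w z) = 1" if "z \<in> torus" for z
    unfolding w_def by (rule norm_character[OF that])
  have w: "w \<in> multiplier P P'"
    unfolding w_def by (rule bandwidth_multiplier[OF bandwidth_character]) (use pos_add_mem K0 in simp)
  have pw0: "(\<lambda>z. complex_of_real (p z) * w z) \<in> multiplier P P'"
    unfolding w_def
  proof (rule bandwidth_multiplier[OF bandwidth_mult[OF p bandwidth_character]])
    fix m k assume "m \<in> {m + k |m k. m \<in> F \<and> k \<in> {K}}" and "k \<in> P"
    then obtain l where "l \<in> F" "m = l + K"
      by blast
    then show "m + k \<in> P'"
      using pos_add_mem[OF K \<open>k \<in> P\<close>] by blast
  qed
  have pw: "(\<lambda>z. complex_of_real (p z) * w z ^ Suc i) \<in> multiplier P P'" for i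
  proof (cases i)
    case 0
    then show ?thesis using pw0 by simp
  next
    case (Suc j)
    \<comment> \<open>One factor w is kept with p, since p alone need not map \<open>P\<close> into
      \<open>P'\<close>.\<close>
    have "(\<lambda>z. (complex_of_real (p z) * w z) * w z ^ Suc j) \<in> multiplier P P'"
      by (intro multiplier_mult[OF pw0 multiplier_power[OF w]]) auto
    then show ?thesis
      by (simp only: Suc power_Suc[of _ "Suc j"] mult.assoc)
  qed
  have M_le: "\<bar>p z\<bar> \<le> M" if "z \<in> torus" for z
    using bspec[OF M that] by simp
  show ?thesis
  proof (intro exI conjI allI impI)
    show "K \<noteq> 0"
      using K0 by simp
    fix r :: real assume r: "0 \<le> r \<and> r < 1"
    let ?c = "\<lambda>i. complex_of_real (- 2 * r ^ Suc i)"
    let ?u = "\<lambda>n z. \<Sum>i<n. ?c i * (complex_of_real (p z) * w z ^ Suc i)"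
    let ?v = "\<lambda>z. - 2 * complex_of_real (p z) * (complex_of_real r * w z / (1 - complex_of_real r * w z))"
    have "0 \<le> M"
      using bspec[OF M, of "(1, 1)"] by (simp add: torus_def)
    have geometric: "(\<lambda>i. 2 * M * r ^ Suc i) sums (2 * M * (r / (1 - r)))"
      using sums_mult[OF geometric_sums[of r], of "2 * M * r"] r by (simp add: mult.assoc)
    have bound: "norm (?u n z) \<le> 2 * M * (r / (1 - r))" if z: "z \<in> torus" for n z
    proof -
      have "norm (?u n z) \<le> (\<Sum>i<n. 2 * M * r ^ Suc i)"
      proof (rule sum_norm_le)
        fix i
        have "norm (?c i * (complex_of_real (p z) * w z ^ Suc i)) = 2 * r ^ Suc i * \<bar>p z\<bar>"
          using r by (simp add: norm_mult norm_power norm_w[OF z])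
        also have "\<dots> \<le> 2 * r ^ Suc i * M"
          by (intro mult_left_mono M_le z) (use r in simp)
        finally show "norm (?c i * (complex_of_real (p z) * w z ^ Suc i)) \<le> 2 * M * r ^ Suc i"
          by (simp add: mult_ac)
      qed
      also have "\<dots> \<le> 2 * M * (r / (1 - r))"
        unfolding sums_unique[OF geometric] using r \<open>0 \<le> M\<close>
        by (intro sum_le_suminf sums_summable[OF geometric]) simp_all
      finally show ?thesis .
    qed
    have lim: "(\<lambda>n. ?u n z) \<longlonglongrightarrow> ?v z" if z: "z \<in> torus" for z
    proof -
      have "norm (r * w z) < 1"
        using r by (simp add: norm_mult norm_w[OF z])
      from sums_mult[OF geometric_sums[OF this], of "- 2 * complex_of_real (p z) * (complex_of_real r * w z)"]
      show ?thesis
        by (simp add: sums_def power_mult_distrib mult_ac)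
    qed
    have v: "?v \<in> multiplier P P'"
    proof (rule multiplier_bounded_limit[where u = ?u])
      show "?u n \<in> multiplier P P'" for n
        by (intro multiplier_sum multiplier_cmult pw)
      show "AE z in haar. norm (?u n z) \<le> 2 * M * (r / (1 - r))" for n
        using bound by (intro AE_I2) simp
      show "AE z in haar. (\<lambda>n. ?u n z) \<longlonglongrightarrow> ?v z"
        using lim by (intro AE_I2) simp
      have "(\<lambda>z. complex_of_real (p z)) \<in> borel_measurable haar"
        by (rule Linf_measurable[OF bandwidth_Linf[OF p]])
      moreover have "w \<in> borel_measurable haar"
        by (simp add: w_def)
      ultimately show "?v \<in> borel_measurable haar"
        by measurable
    qed
    have "AE z in haar. norm (?v z) \<le> 2 * M * (r / (1 - r))"
    proof (rule AE_I2)
      fix z assume "z \<in> space haar"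
      then have z: "z \<in> torus" by simp
      show "norm (?v z) \<le> 2 * M * (r / (1 - r))"
        by (rule Lim_bounded[OF tendsto_norm[OF lim[OF z]]]) (use bound[OF z] in blast)
    qed
    from multiplier_exp[OF v _ this]
    show "(\<lambda>z. exp (- 2 * complex_of_real (p z) * (complex_of_real r * character K z / (1 - complex_of_real r * character K z))) - 1) \<in> multiplier P P'"
      unfolding w_def by simp
  qed
qed

text \<open>The previous lemma is used in the limit \<open>r \<rightarrow> 1\<close>: the exponential stays bounded by \<open>e\<^sup>p\<close> because
  \<open>Re (x / (1 - x)) \<ge> - 1/2\<close> in the unit disc.\<close>

lemma exp_factor:
  assumes F: "finite F" and p: "bandwidth F (\<lambda>z. complex_of_real (p z))"
    and M: "\<forall>z\<in>torus. 0 \<le> p z \<and> p z \<le> M"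
  obtains a where "a \<in> Linf haar" "(\<lambda>z. a z - 1) \<in> multiplier P P'"
    "AE z in haar. norm (a z) = exp (p z)"
proof -
  from multiplier_Poisson[OF F p M] obtain K where K: "K \<noteq> 0"
    and mem: "\<forall>r. 0 \<le> r \<and> r < 1 \<longrightarrow>
      (\<lambda>z. exp (- 2 * complex_of_real (p z) * (complex_of_real r * character K z / (1 - complex_of_real r * character K z))) - 1) \<in> multiplier P P'"
    by (elim exE conjE)
  define w where "w = character K"
  \<comment> \<open>Starts at 1/2, so that every radius lies in the interval [0, 1).\<close>
  define r where "r n = 1 - 1 / real (Suc (Suc n))" for n
  have r: "0 \<le> r n" "r n < 1" for n
    by (simp_all add: r_def)
  have "r \<longlonglongrightarrow> 1 - 0"
    unfolding r_def
    by (intro tendsto_diff tendsto_const LIMSEQ_Suc[OF LIMSEQ_Suc[OF lim_const_over_n]])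
  then have r_lim: "(\<lambda>n. complex_of_real (r n)) \<longlonglongrightarrow> 1"
    using tendsto_of_real[of r 1 sequentially] by simp
  define a where "a z = exp (- 2 * complex_of_real (p z) * (w z / (1 - w z)))" for z
  have norm_w: "norm (w z) = 1" if "z \<in> torus" for z
    unfolding w_def by (rule norm_character[OF that])
  have [measurable]: "w \<in> borel_measurable haar"
    by (simp add: w_def)
  have [measurable]: "(\<lambda>z. complex_of_real (p z)) \<in> borel_measurable haar"
    by (rule Linf_measurable[OF bandwidth_Linf[OF p]])
  have a_meas: "a \<in> borel_measurable haar"
    unfolding a_def by measurable
  let ?u = "\<lambda>n z. exp (- 2 * complex_of_real (p z) * (complex_of_real (r n) * w z / (1 - complex_of_real (r n) * w z))) - 1"
  have w_ne: "AE z in haar. w z \<noteq> 1"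
    unfolding w_def by (rule AE_character_neq_1[OF K])
  have a1: "(\<lambda>z. a z - 1) \<in> multiplier P P'"
  proof (rule multiplier_bounded_limit[where u = ?u and B = "exp M + 1"])
    show "?u n \<in> multiplier P P'" for n
      unfolding w_def by (rule mem[rule_format]) (intro conjI r)
    show "AE z in haar. norm (?u n z) \<le> exp M + 1" for n
    proof (rule AE_I2)
      fix z assume "z \<in> space haar"
      then have z: "z \<in> torus" by simp
      let ?x = "complex_of_real (r n) * w z"
      have x: "norm ?x < 1"
        using r[of n] by (simp add: norm_mult norm_w[OF z])
      then have "?x \<noteq> 1"
        by (metis norm_one less_irrefl)
      have "(norm ?x)\<^sup>2 \<le> 1"
        using x by (simp add: power_le_one_iff)
      then have "- 1 / 2 \<le> Re (?x / (1 - ?x))"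
        unfolding Re_geometric[OF \<open>?x \<noteq> 1\<close>] by (simp add: divide_nonneg_nonneg)
      then have "p z * (- 1 / 2) \<le> p z * Re (?x / (1 - ?x))"
        by (rule mult_left_mono) (use bspec[OF M z] in simp)
      moreover have "Re (- 2 * complex_of_real (p z) * (?x / (1 - ?x))) = - 2 * (p z * Re (?x / (1 - ?x)))"
        by (rule Re_minus_two_mult)
      ultimately have "Re (- 2 * complex_of_real (p z) * (?x / (1 - ?x))) \<le> M"
        using bspec[OF M z] by linarith
      then have "norm (exp (- 2 * complex_of_real (p z) * (?x / (1 - ?x)))) \<le> exp M"
        by (simp only: norm_exp_eq_Re exp_le_cancel_iff)
      then show "norm (?u n z) \<le> exp M + 1"
        by (intro norm_triangle_le_diff) simp
    qed
    show "AE z in haar. (\<lambda>n. ?u n z) \<longlonglongrightarrow> a z - 1"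
      using w_ne
    proof eventually_elim
      case (elim z)
      have x: "(\<lambda>n. complex_of_real (r n) * w z) \<longlonglongrightarrow> w z"
        using tendsto_mult[OF r_lim tendsto_const[of "w z"]] by simp
      have "1 - w z \<noteq> 0"
        using elim by simp
      with x show ?case
        unfolding a_def by (intro tendsto_intros)
    qed
    show "(\<lambda>z. a z - 1) \<in> borel_measurable haar"
      using a_meas by simp
  qed
  have "(\<lambda>z. (a z - 1) + 1) \<in> Linf haar"
    by (rule Linf_add[OF multiplier_Linf[OF a1] Linf_const])
  then have "a \<in> Linf haar"
    by simp
  moreover have "AE z in haar. norm (a z) = exp (p z)"
    using w_ne AE_space
  proof eventually_elim
    case (elim z)
    \<comment> \<open>On the circle the real part is exactly -1/2, so the exponent has real part
      \<open>p z\<close>; off the null set w = 1 the modulus is therefore attained, not just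
      bounded.\<close>
    then have "Re (w z / (1 - w z)) = - 1 / 2"
      using Re_geometric[of "w z"] norm_w[of z] by simp
    moreover have "Re (- 2 * complex_of_real (p z) * (w z / (1 - w z))) = - 2 * (p z * Re (w z / (1 - w z)))"
      by (rule Re_minus_two_mult)
    ultimately show ?case
      unfolding a_def norm_exp_eq_Re by simp
  qed
  ultimately show ?thesis
    using a1 that by blast
qed

text \<open>The square expands to |a|^2 + 1 - 2 Re a, and a has mean 1 because a - 1 has mean 0. The
  phase of a drops out.\<close>

lemma integral_sq_minus_1:
  assumes a: "a \<in> Linf haar" "(\<lambda>z. a z - 1) \<in> multiplier P P'"
    and p: "AE z in haar. norm (a z) = exp (p z)" "(\<lambda>z. exp (2 * p z)) \<in> borel_measurable haar"
  shows "(LINT z|haar. (norm (a z - 1))\<^sup>2) = (LINT z|haar. exp (2 * p z) - 1)"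
proof -
  have int: "integrable haar a"
    by (rule integrable_Linf[OF a(1)])
  have "(LINT z|haar. (a z - 1) + 1) = (LINT z|haar. a z - 1) + (LINT z|haar. 1)"
    by (intro Bochner_Integration.integral_add integrable_Linf multiplier_Linf[OF a(2)] Linf_const)
  then have "(LINT z|haar. a z) = 1"
    using integral_of_multiplier[OF a(2)] by simp
  then have re: "(LINT z|haar. Re (a z)) = 1"
    using integral_Re[OF int] by simp
  have eq: "AE z in haar. (norm (a z - 1))\<^sup>2 = (exp (2 * p z) - 1) + (2 - 2 * Re (a z))"
    using p(1)
  proof eventually_elim
    case (elim z)
    have "(norm (a z - 1))\<^sup>2 = (norm (a z))\<^sup>2 + 1 - 2 * Re (a z)"
      unfolding cmod_power2 by (simp add: power2_eq_square algebra_simps)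
    then show ?case
      using elim by (simp add: exp_double)
  qed
  obtain B where "AE z in haar. norm (a z) \<le> B"
    using a(1) by (rule LinfE)
  then have "AE z in haar. norm (exp (2 * p z)) \<le> B\<^sup>2"
    using p(1)
  proof eventually_elim
    case (elim z)
    then have "exp (p z) \<le> B"
      by simp
    then have "(exp (p z))\<^sup>2 \<le> B\<^sup>2"
      by (rule power_mono) simp
    then show ?case
      by (simp add: exp_double)
  qed
  then have "integrable haar (\<lambda>z. exp (2 * p z))"
    using p(2) by (rule haar.integrable_const_bound)
  then have int2: "integrable haar (\<lambda>z. exp (2 * p z) - 1)" by simp
  have "(LINT z|haar. (norm (a z - 1))\<^sup>2) = (LINT z|haar. (exp (2 * p z) - 1) + (2 - 2 * Re (a z)))"
  proof (rule integral_cong_AE[OF _ _ eq])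
    have [measurable]: "a \<in> borel_measurable haar" "(\<lambda>z. exp (2 * p z)) \<in> borel_measurable haar"
      by (rule Linf_measurable[OF a(1)]) (rule p(2))
    show "(\<lambda>z. (norm (a z - 1))\<^sup>2) \<in> borel_measurable haar"
      by measurable
    have "(\<lambda>z. Re (a z)) \<in> borel_measurable haar"
      by measurable
    then show "(\<lambda>z. exp (2 * p z) - 1 + (2 - 2 * Re (a z))) \<in> borel_measurable haar"
      using p(2) by (intro borel_measurable_add borel_measurable_diff borel_measurable_times borel_measurable_const)
  qed
  also have "\<dots> = (LINT z|haar. exp (2 * p z) - 1) + (LINT z|haar. 2 - 2 * Re (a z))"
    using int2 int by (intro Bochner_Integration.integral_add) auto
  also have "(LINT z|haar. 2 - 2 * Re (a z)) = 0"
    using int re by (subst Bochner_Integration.integral_diff) auto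
  finally show ?thesis by simp
qed

end

section \<open>Lower semicontinuous functions as limits of polynomials\<close>

lemma lower_semicontinuous_on_sequentially:
  fixes S :: "'a::metric_space set"
  assumes f: "lower_semicontinuous_on S f" and x: "\<And>n. X n \<in> S" "X \<longlonglongrightarrow> x" "x \<in> S" and c: "c < f x"
  shows "eventually (\<lambda>n. c < f (X n)) sequentially"
proof -
  have "eventually (\<lambda>y. c < f y) (at x within S)"
    using f x(3) c unfolding lower_semicontinuous_on_def by blast
  \<comment> \<open>The filter \<open>at x within S\<close> disregards \<open>x\<close> itself;
    terms of the sequence equal to \<open>x\<close> are settled by the assumption on
    \<open>c\<close>.\<close>
  then have "eventually (\<lambda>y. y \<noteq> x \<longrightarrow> y \<in> S \<longrightarrow> c < f y) (nhds x)"
    by (simp add: eventually_at_filter)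
  then have "eventually (\<lambda>n. X n \<noteq> x \<longrightarrow> X n \<in> S \<longrightarrow> c < f (X n)) sequentially"
    using x(2) by (rule eventually_compose_filterlim)
  then show ?thesis
    by eventually_elim (use x(1) c in metis)
qed

text \<open>A sequence along which \<open>f\<close> falls below 1/(n+1) would cluster at a point
  near which \<open>f\<close> stays above half of its positive value there. The bound keeps ln f
  bounded below and makes the reciprocal of the factor bounded.\<close>

lemma lower_semicontinuous_on_pos_lower_bound:
  fixes S :: "'a::metric_space set"
  assumes f: "lower_semicontinuous_on S f" and S: "compact S" and pos: "\<forall>x\<in>S. 0 < f x"
  shows "\<exists>c>0. \<forall>x\<in>S. c \<le> f x"
proof (rule ccontr)
  assume "\<not> ?thesis"
  then have "\<exists>x\<in>S. f x < inverse (real (Suc n))" for n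
    by (metis inverse_positive_iff_positive not_le of_nat_0_less_iff zero_less_Suc)
  then obtain X where X: "\<And>n. X n \<in> S" "\<And>n. f (X n) < inverse (real (Suc n))"
    by metis
  obtain x r where x: "x \<in> S" "strict_mono r" "(X \<circ> r) \<longlonglongrightarrow> x"
    by (rule seq_compactE[OF S[unfolded compact_eq_seq_compact_metric], of X]) (simp_all add: X(1))
  have "eventually (\<lambda>n. f x / 2 < f ((X \<circ> r) n)) sequentially"
  proof (rule lower_semicontinuous_on_sequentially[OF f _ x(3,1)])
    show "(X \<circ> r) n \<in> S" for n
      by (simp add: X(1))
    show "f x / 2 < f x"
      using bspec[OF pos x(1)] by simp
  qed
  moreover have "eventually (\<lambda>n. f ((X \<circ> r) n) < f x / 2) sequentially"
  proof -
    have "(\<lambda>n. inverse (real (Suc (r n)))) \<longlonglongrightarrow> 0"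
      using LIMSEQ_subseq_LIMSEQ[OF LIMSEQ_inverse_real_of_nat x(2)] by (simp add: o_def)
    then have "eventually (\<lambda>n. inverse (real (Suc (r n))) < f x / 2) sequentially"
      by (rule order_tendstoD) (use bspec[OF pos x(1)] in simp)
    then show ?thesis
    proof eventually_elim
      case (elim n)
      show ?case
        using less_trans[OF X(2)[of "r n"] elim] by (simp only: o_apply)
    qed
  qed
  ultimately have "eventually (\<lambda>n. False) sequentially"
    by eventually_elim simp
  then show False
    by simp
qed

text \<open>The Pasch-Hausdorff envelope: for \<open>h\<close> bounded below on \<open>S\<close>,
  the largest function with Lipschitz constant \<open>n\<close> that stays below \<open>h\<close> on
  \<open>S\<close>.\<close>

definition lipschitz_minorant :: "'a::metric_space set \<Rightarrow> ('a \<Rightarrow> real) \<Rightarrow> nat \<Rightarrow> 'a \<Rightarrow> real" where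
  "lipschitz_minorant S h n x = (INF y\<in>S. h y + real n * dist x y)"

context
  fixes S :: "'a::metric_space set" and h :: "'a \<Rightarrow> real" and m :: real
  assumes ne: "S \<noteq> {}" and lower: "\<And>y. y \<in> S \<Longrightarrow> m \<le> h y"
begin

lemma lipschitz_minorant_le:
  assumes "y \<in> S"
  shows "lipschitz_minorant S h n x \<le> h y + real n * dist x y"
  unfolding lipschitz_minorant_def
proof (rule cINF_lower[OF _ assms])
  have "m \<le> h y + real n * dist x y" if "y \<in> S" for y
    using lower[OF that] by (simp add: add_increasing2)
  then show "bdd_below ((\<lambda>y. h y + real n * dist x y) ` S)"
    by (intro bdd_belowI[of _ m]) auto
qed

lemma lipschitz_minorant_ge:
  assumes "\<And>y. y \<in> S \<Longrightarrow> c \<le> h y + real n * dist x y"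
  shows "c \<le> lipschitz_minorant S h n x"
  unfolding lipschitz_minorant_def by (rule cINF_greatest[OF ne assms])

lemma lipschitz_minorant_lower: "m \<le> lipschitz_minorant S h n x"
  by (rule lipschitz_minorant_ge) (simp add: lower add_increasing2)

lemma lipschitz_minorant_upper: "x \<in> S \<Longrightarrow> lipschitz_minorant S h n x \<le> h x"
  using lipschitz_minorant_le[of x n x] by simp

lemma lipschitz_minorant_mono:
  assumes "k \<le> n"
  shows "lipschitz_minorant S h k x \<le> lipschitz_minorant S h n x"
proof (rule lipschitz_minorant_ge)
  fix y assume y: "y \<in> S"
  have "real k * dist x y \<le> real n * dist x y"
    using assms by (simp add: mult_right_mono)
  then show "lipschitz_minorant S h k x \<le> h y + real n * dist x y"
    using lipschitz_minorant_le[OF y, of k x] by linarith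
qed

lemma lipschitz_minorant_continuous: "continuous_on A (lipschitz_minorant S h n)"
proof -
  have *: "lipschitz_minorant S h n x \<le> lipschitz_minorant S h n x' + real n * dist x x'" for x x'
  proof -
    have "lipschitz_minorant S h n x - real n * dist x x' \<le> lipschitz_minorant S h n x'"
    proof (rule lipschitz_minorant_ge)
      fix y assume y: "y \<in> S"
      have "real n * dist x y \<le> real n * (dist x x' + dist x' y)"
        by (intro mult_left_mono dist_triangle) simp
      then show "lipschitz_minorant S h n x - real n * dist x x' \<le> h y + real n * dist x' y"
        using lipschitz_minorant_le[OF y, of n x] by (simp add: distrib_left)
    qed
    then show ?thesis by linarith
  qed
  have "(real n)-lipschitz_on A (lipschitz_minorant S h n)"
  proof (rule lipschitz_onI)
    show "dist (lipschitz_minorant S h n x) (lipschitz_minorant S h n x') \<le> real n * dist x x'" for x x'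
      using *[of x x'] *[of x' x] by (simp add: dist_real_def dist_commute abs_le_iff)
  qed simp
  then show ?thesis
    by (rule lipschitz_on_continuous_on)
qed

text \<open>Points near \<open>x\<close> are handled by lower semicontinuity. For points at distance
  at least \<open>e\<close> the penalty n e eventually exceeds the possible drop from
  \<open>d\<close> to the lower bound \<open>m\<close>.\<close>

lemma lipschitz_minorant_tendsto:
  assumes h: "lower_semicontinuous_on S h" and x: "x \<in> S"
  shows "(\<lambda>n. lipschitz_minorant S h n x) \<longlonglongrightarrow> h x"
proof (rule order_tendstoI)
  fix c assume "h x < c"
  then show "eventually (\<lambda>n. lipschitz_minorant S h n x < c) sequentially"
    using lipschitz_minorant_upper[OF x] le_less_trans by (intro always_eventually) blast
next
  fix c assume "c < h x"
  then obtain d where d: "c < d" "d < h x"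
    using dense by blast
  then have "eventually (\<lambda>y. d < h y) (at x within S)"
    using h x unfolding lower_semicontinuous_on_def by blast
  then obtain e where e: "e > 0" "\<And>y. y \<in> S \<Longrightarrow> y \<noteq> x \<Longrightarrow> dist y x < e \<Longrightarrow> d < h y"
    unfolding eventually_at by blast
  obtain N :: nat where N: "(d - m) / e < real N"
    using reals_Archimedean2 by blast
  show "eventually (\<lambda>n. c < lipschitz_minorant S h n x) sequentially"
  proof (rule eventually_mono[OF eventually_ge_at_top[of N]])
    fix n assume "N \<le> n"
    have "d \<le> lipschitz_minorant S h n x"
    proof (rule lipschitz_minorant_ge)
      fix y assume y: "y \<in> S"
      show "d \<le> h y + real n * dist x y"
      proof (cases "dist y x < e")
        case True
        then have "d < h y"
          using e(2)[OF y] d(2) by (cases "y = x") auto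
        then show ?thesis
          by (simp add: add_increasing2)
      next
        case False
        have "d - m \<le> real N * e"
          using N e(1) by (simp add: divide_less_eq)
        also have "\<dots> \<le> real n * dist x y"
          using False \<open>N \<le> n\<close> e(1) by (intro mult_mono) (auto simp: dist_commute)
        finally show ?thesis
          using lower[OF y] by linarith
      qed
    qed
    then show "c < lipschitz_minorant S h n x"
      using d(1) by linarith
  qed
qed

end

section \<open>Approximation from below on the torus\<close>

lemma compact_torus: "compact torus"
  unfolding torus_def by (intro compact_Times compact_sphere)

lemma torus_nonempty: "torus \<noteq> {}"
  unfolding torus_def by (simp add: sphere_eq_empty)

lemma continuous_on_torus_measurable:
  "continuous_on torus f \<Longrightarrow> f \<in> borel_measurable haar"
  by (simp add: measurable_cong_sets[OF sets_haar refl] borel_measurable_continuous_on_restrict)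

text \<open>The Lipschitz minorants are taken along a subsequence that makes the integrals decay,
  lowered slightly and approximated by polynomials. The lowering pays for the approximation error,
  so monotonicity and the bound by \<open>h\<close> survive.\<close>

lemma lower_semicontinuous_polynomial_approximation:
  fixes h :: "complex \<times> complex \<Rightarrow> real"
  assumes h: "lower_semicontinuous_on torus h"
    and lower: "\<And>z. z \<in> torus \<Longrightarrow> m \<le> h z" and upper: "\<And>z. z \<in> torus \<Longrightarrow> h z \<le> M"
  obtains t :: "nat \<Rightarrow> complex \<times> complex \<Rightarrow> real"
  where "\<And>n. real_polynomial_function (t n)"
    and "\<And>n z. z \<in> torus \<Longrightarrow> t n z \<le> t (Suc n) z"
    and "\<And>n z. z \<in> torus \<Longrightarrow> m - 2 \<le> t n z"
    and "\<And>n z. z \<in> torus \<Longrightarrow> t n z \<le> h z"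
    and "\<And>z. z \<in> torus \<Longrightarrow> (\<lambda>n. t n z) \<longlonglongrightarrow> h z"
    and "\<And>n. (LINT z|haar. h z - t n z) \<le> 3 * (1/4) ^ n"
    and "h \<in> borel_measurable haar"
proof -
  define \<phi> where "\<phi> = lipschitz_minorant torus h"
  note ctx = torus_nonempty lower
  have cont: "continuous_on torus (\<phi> n)" for n
    unfolding \<phi>_def by (rule lipschitz_minorant_continuous[OF ctx])
  have mono: "\<phi> k z \<le> \<phi> n z" if "k \<le> n" for k n z
    unfolding \<phi>_def by (rule lipschitz_minorant_mono[OF ctx that])
  have \<phi>_le: "\<phi> n z \<le> h z" if "z \<in> torus" for n z
    unfolding \<phi>_def by (rule lipschitz_minorant_upper[OF ctx that])
  have \<phi>_ge: "m \<le> \<phi> n z" for n z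
    unfolding \<phi>_def by (rule lipschitz_minorant_lower[OF ctx])
  have lim: "(\<lambda>n. \<phi> n z) \<longlonglongrightarrow> h z" if "z \<in> torus" for z
    unfolding \<phi>_def by (rule lipschitz_minorant_tendsto[OF ctx h that])
  have \<phi>_meas [measurable]: "\<phi> n \<in> borel_measurable haar" for n
    by (rule continuous_on_torus_measurable[OF cont])
  have h_meas [measurable]: "h \<in> borel_measurable haar"
    by (rule borel_measurable_LIMSEQ_real[OF _ \<phi>_meas]) (use lim in simp)
  have "(\<lambda>n. LINT z|haar. h z - \<phi> n z) \<longlonglongrightarrow> (LINT z|haar. 0)"
  proof (rule integral_dominated_convergence[where w = "\<lambda>_. M - m"])
    show "AE z in haar. (\<lambda>n. h z - \<phi> n z) \<longlonglongrightarrow> 0"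
    proof (rule AE_I2)
      fix z assume "z \<in> space haar"
      then show "(\<lambda>n. h z - \<phi> n z) \<longlonglongrightarrow> 0"
        using tendsto_diff[OF tendsto_const[of "h z"] lim[of z]] by simp
    qed
    show "AE z in haar. norm (h z - \<phi> n z) \<le> M - m" for n
    proof (rule AE_I2)
      fix z assume "z \<in> space haar"
      then have z: "z \<in> torus" by simp
      show "norm (h z - \<phi> n z) \<le> M - m"
        using \<phi>_le[OF z, of n] \<phi>_ge[of n z] upper[OF z] by simp
    qed
  qed simp_all
  then have int_lim: "(\<lambda>n. LINT z|haar. h z - \<phi> n z) \<longlonglongrightarrow> 0"
    by simp
  have "\<exists>K. \<forall>k\<ge>K. (LINT z|haar. h z - \<phi> k z) \<le> (1/4) ^ n" for n
  proof -
    have "eventually (\<lambda>k. (LINT z|haar. h z - \<phi> k z) < (1/4) ^ n) sequentially"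
      by (rule order_tendstoD(2)[OF int_lim]) simp
    then show ?thesis
      unfolding eventually_sequentially using less_imp_le by blast
  qed
  then obtain K where K: "\<And>n k. K n \<le> k \<Longrightarrow> (LINT z|haar. h z - \<phi> k z) \<le> (1/4) ^ n"
    by metis
  \<comment> \<open>The sum secures three properties at once: \<open>k\<close> increases, and
    \<open>k n\<close> is at least \<open>n\<close> and at least \<open>K n\<close>.\<close>
  define k where "k n = (\<Sum>i\<le>n. Suc (K i))" for n
  have k_Suc: "k n \<le> k (Suc n)" for n
    by (simp add: k_def)
  have k_ge: "n \<le> k n" for n
    by (induction n) (auto simp: k_def)
  have k_K: "K n \<le> k n" for n
    unfolding k_def by (rule order_trans[OF _ member_le_sum[of n]]) auto
  define \<delta> :: "nat \<Rightarrow> real" where "\<delta> n = (1/4) ^ n" for n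
  have \<delta>: "0 < \<delta> n" "\<delta> (Suc n) = \<delta> n / 4" "\<delta> n \<le> 1" for n
    by (simp_all add: \<delta>_def power_le_one)
  \<comment> \<open>The polynomial \<open>t n\<close> stays below \<open>\<phi> (k n)\<close> - 3/4
    \<open>\<delta> n\<close>, while the next one stays above \<open>\<phi> (k (Suc n))\<close> -
    5/16 \<open>\<delta> n\<close>, because \<delta> drops by a factor 4. This gap gives
    monotonicity.\<close>
  have "\<exists>t. real_polynomial_function t \<and> (\<forall>z\<in>torus. \<bar>(\<phi> (k n) z - \<delta> n) - t z\<bar> < \<delta> n / 4)" for n
    by (rule Stone_Weierstrass_real_polynomial_function[OF compact_torus, of "\<lambda>z. \<phi> (k n) z - \<delta> n" "\<delta> n / 4"])
      (use \<delta>(1) in \<open>auto intro!: continuous_intros cont\<close>)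
  then obtain t where poly: "\<And>n. real_polynomial_function (t n)"
    and near: "\<And>n z. z \<in> torus \<Longrightarrow> \<bar>(\<phi> (k n) z - \<delta> n) - t n z\<bar> < \<delta> n / 4"
    by metis
  have t_le: "t n z \<le> h z" if "z \<in> torus" for n z
    using near[OF that, of n] \<phi>_le[OF that, of "k n"] \<delta>(1)[of n] by linarith
  have t_ge: "\<phi> (k n) z - 2 * \<delta> n \<le> t n z" if "z \<in> torus" for n z
    using near[OF that, of n] \<delta>(1)[of n] by linarith
  show ?thesis
  proof (rule that[OF poly])
    fix n z assume z: "z \<in> torus"
    show "t n z \<le> t (Suc n) z"
      using near[OF z, of n] near[OF z, of "Suc n"] mono[OF k_Suc[of n], of z] \<delta>(1)[of n] \<delta>(2)[of n]
      by linarith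
    show "m - 2 \<le> t n z"
      using t_ge[OF z, of n] \<phi>_ge[of "k n" z] \<delta>(3)[of n] by linarith
    show "t n z \<le> h z"
      by (rule t_le[OF z])
  next
    fix z assume z: "z \<in> torus"
    show "(\<lambda>n. t n z) \<longlonglongrightarrow> h z"
    proof (rule tendsto_sandwich)
      show "eventually (\<lambda>n. \<phi> n z - 2 * \<delta> n \<le> t n z) sequentially"
      proof (intro always_eventually allI)
        show "\<phi> n z - 2 * \<delta> n \<le> t n z" for n
          using t_ge[OF z, of n] mono[OF k_ge[of n], of z] by linarith
      qed
      show "eventually (\<lambda>n. t n z \<le> h z) sequentially"
        using t_le[OF z] by simp
      have "\<delta> \<longlonglongrightarrow> 0"
        unfolding \<delta>_def by (rule LIMSEQ_power_zero) simp
      then show "(\<lambda>n. \<phi> n z - 2 * \<delta> n) \<longlonglongrightarrow> h z"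
        using tendsto_diff[OF lim[OF z] tendsto_mult_right_zero[of \<delta> sequentially 2]] by simp
    qed simp
  next
    fix n
    have t_meas [measurable]: "t n \<in> borel_measurable haar"
      using poly[of n] by (intro continuous_on_torus_measurable continuous_on_polymonial_function)
        (simp add: real_polynomial_function_eq)
    have int1: "integrable haar (\<lambda>z. h z - \<phi> (k n) z)"
      by (rule haar.integrable_const_bound[of _ "M - m"])
        (use \<phi>_le \<phi>_ge upper in \<open>auto intro!: AE_I2 simp: diff_mono\<close>)
    have int2: "integrable haar (\<lambda>z. h z - t n z)"
    proof (rule haar.integrable_const_bound[of _ "M - m + 2"])
      show "AE z in haar. norm (h z - t n z) \<le> M - m + 2"
      proof (rule AE_I2)
        fix z assume "z \<in> space haar"
        then have z: "z \<in> torus" by simp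
        show "norm (h z - t n z) \<le> M - m + 2"
          using t_le[OF z, of n] t_ge[OF z, of n] \<phi>_ge[of "k n" z] upper[OF z] \<delta>(3)[of n] by simp
      qed
    qed simp
    \<comment> \<open>Of the constant 3, one unit comes from the choice of \<open>K\<close> and two
      from the loss 2 \<open>\<delta> n\<close>.\<close>
    have "(LINT z|haar. h z - t n z) \<le> (LINT z|haar. (h z - \<phi> (k n) z) + 2 * \<delta> n)"
    proof (rule integral_mono[OF int2])
      fix z assume "z \<in> space haar"
      then have z: "z \<in> torus" by simp
      show "h z - t n z \<le> (h z - \<phi> (k n) z) + 2 * \<delta> n"
        using t_ge[OF z, of n] by linarith
    qed (use int1 in simp)
    also have "\<dots> = (LINT z|haar. h z - \<phi> (k n) z) + 2 * \<delta> n"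
      using int1 by (subst Bochner_Integration.integral_add) simp_all
    also have "\<dots> \<le> 3 * (1/4) ^ n"
      using K[OF k_K[of n]] by (simp add: \<delta>_def)
    finally show "(LINT z|haar. h z - t n z) \<le> 3 * (1/4) ^ n" .
  next
    show "h \<in> borel_measurable haar" by (rule h_meas)
  qed
qed

section \<open>Bounded functions of prescribed modulus\<close>

text \<open>By monotone convergence the sum has a finite integral, so it is finite almost
  everywhere.\<close>

lemma AE_summable_of_summable_integral:
  fixes u :: "nat \<Rightarrow> 'a \<Rightarrow> real"
  assumes int: "\<And>n. integrable M (u n)" and nn: "\<And>n x. 0 \<le> u n x"
    and sum: "summable (\<lambda>n. integral\<^sup>L M (u n))"
  shows "AE x in M. summable (\<lambda>n. u n x)"
proof -
  have [measurable]: "u n \<in> borel_measurable M" for n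
    using int by (rule borel_measurable_integrable)
  have "(\<integral>\<^sup>+x. (\<Sum>n. ennreal (u n x)) \<partial>M) = (\<Sum>n. \<integral>\<^sup>+x. ennreal (u n x) \<partial>M)"
    by (rule nn_integral_suminf) measurable
  also have "\<dots> = (\<Sum>n. ennreal (integral\<^sup>L M (u n)))"
    by (simp add: nn_integral_eq_integral[OF int] nn)
  also have "\<dots> = ennreal (\<Sum>n. integral\<^sup>L M (u n))"
    by (rule suminf_ennreal2[OF _ sum]) (simp add: nn)
  finally have "(\<integral>\<^sup>+x. (\<Sum>n. ennreal (u n x)) \<partial>M) \<noteq> \<infinity>"
    by simp
  then have "AE x in M. (\<Sum>n. ennreal (u n x)) \<noteq> \<infinity>"
    by (intro nn_integral_PInf_AE) measurable
  then show ?thesis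
    by eventually_elim (rule summable_suminf_not_top, simp_all add: nn)
qed

text \<open>The inequality 1 - x <= exp (-x), multiplied by exp x. It bounds exp (2 p) - 1 by a
  multiple of p when p >= 0 is bounded.\<close>

lemma exp_minus_one_le: "exp x - 1 \<le> x * exp x" for x :: real
proof -
  have "(1 - x) * exp x \<le> exp (- x) * exp x"
    using exp_ge_add_one_self[of "- x"] by (intro mult_right_mono) simp_all
  then show ?thesis
    by (simp add: left_diff_distrib flip: exp_add)
qed

context deep_cone
begin

lemma exp_polynomial_factor:
  fixes q :: "complex \<times> complex \<Rightarrow> real"
  assumes q: "real_polynomial_function q" and M: "\<forall>z\<in>torus. 0 \<le> q z \<and> q z \<le> M"
  obtains a where "a \<in> Linf haar" "(\<lambda>z. a z - 1) \<in> multiplier P P'"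
    "AE z in haar. norm (a z) = exp (q z)"
proof -
  obtain F where "finite F" "bandwidth F (\<lambda>z. complex_of_real (q z))"
    using bandwidth_real_polynomial_function[OF q] by (elim exE conjE)
  from exp_factor[OF this M] show ?thesis
    using that by this
qed

text \<open>The partial product \<open>A n\<close> has modulus exp (t n), so it stays bounded by exp
  M, and its spectrum stays in \<open>P\<close>. Mean-square increments of order 4^(-n) are small
  enough for convergence almost everywhere, through which the moduli pass to the limit.\<close>

lemma analytic_modulus:
  fixes h :: "complex \<times> complex \<Rightarrow> real"
  assumes h: "lower_semicontinuous_on torus h"
    and lower: "\<And>z. z \<in> torus \<Longrightarrow> m \<le> h z" and upper: "\<And>z. z \<in> torus \<Longrightarrow> h z \<le> M"
  obtains \<alpha> where "\<alpha> \<in> Linf haar" "Spec \<alpha> \<subseteq> P" "AE z in haar. norm (\<alpha> z) = exp (h z)"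
proof -
  obtain t :: "nat \<Rightarrow> complex \<times> complex \<Rightarrow> real"
    where poly: "\<And>n. real_polynomial_function (t n)"
      and mono: "\<And>n z. z \<in> torus \<Longrightarrow> t n z \<le> t (Suc n) z"
      and t_ge: "\<And>n z. z \<in> torus \<Longrightarrow> m - 2 \<le> t n z"
      and t_le: "\<And>n z. z \<in> torus \<Longrightarrow> t n z \<le> h z"
      and t_lim: "\<And>z. z \<in> torus \<Longrightarrow> (\<lambda>n. t n z) \<longlonglongrightarrow> h z"
      and t_int: "\<And>n. (LINT z|haar. h z - t n z) \<le> 3 * (1/4) ^ n"
      and h_meas: "h \<in> borel_measurable haar"
  proof (rule lower_semicontinuous_polynomial_approximation[OF h lower upper])
    fix t :: "nat \<Rightarrow> complex \<times> complex \<Rightarrow> real"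
    assume "\<And>n. real_polynomial_function (t n)"
      and "\<And>n z. z \<in> torus \<Longrightarrow> t n z \<le> t (Suc n) z"
      and "\<And>n z. z \<in> torus \<Longrightarrow> m - 2 \<le> t n z"
      and "\<And>n z. z \<in> torus \<Longrightarrow> t n z \<le> h z"
      and "\<And>z. z \<in> torus \<Longrightarrow> (\<lambda>n. t n z) \<longlonglongrightarrow> h z"
      and "\<And>n. (LINT z|haar. h z - t n z) \<le> 3 * (1/4) ^ n"
      and "h \<in> borel_measurable haar"
    then show ?thesis
      by (rule that)
  qed
  \<comment> \<open>As m - 2 <= t n <= h <= M, \<open>R\<close> bounds every increment and every
    difference \<open>h - t n\<close>.\<close>
  define R where "R = M - m + 2"
  have t_meas [measurable]: "t n \<in> borel_measurable haar" for n
    using poly[of n] by (intro continuous_on_torus_measurable continuous_on_polymonial_function)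
      (simp add: real_polynomial_function_eq)
  have "\<exists>a. a \<in> Linf haar \<and> (\<lambda>z. a z - 1) \<in> multiplier P P' \<and>
      (AE z in haar. norm (a z) = exp (t (Suc n) z - t n z))" for n
  proof (rule exp_polynomial_factor[of "\<lambda>z. t (Suc n) z - t n z" R])
    show "real_polynomial_function (\<lambda>z. t (Suc n) z - t n z)"
      by (intro real_polynomial_function_diff poly)
    show "\<forall>z\<in>torus. 0 \<le> t (Suc n) z - t n z \<and> t (Suc n) z - t n z \<le> R"
    proof
      fix z assume z: "z \<in> torus"
      show "0 \<le> t (Suc n) z - t n z \<and> t (Suc n) z - t n z \<le> R"
        using mono[OF z, of n] t_ge[OF z, of n] t_le[OF z, of "Suc n"] upper[OF z] by (simp add: R_def)
    qed
  qed (intro exI conjI)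
  then have "\<exists>a. \<forall>n. a n \<in> Linf haar \<and> (\<lambda>z. a n z - 1) \<in> multiplier P P' \<and>
      (AE z in haar. norm (a n z) = exp (t (Suc n) z - t n z))"
    by (intro choice allI)
  then obtain a where a_Linf: "\<And>n. a n \<in> Linf haar"
    and a_mult: "\<And>n. (\<lambda>z. a n z - 1) \<in> multiplier P P'"
    and a_norm: "\<And>n. AE z in haar. norm (a n z) = exp (t (Suc n) z - t n z)"
    by auto
  obtain a0 where a0: "a0 \<in> Linf haar" "(\<lambda>z. a0 z - 1) \<in> multiplier P P'"
    "AE z in haar. norm (a0 z) = exp (t 0 z - (m - 2))"
  proof (rule exp_polynomial_factor[of "\<lambda>z. t 0 z - (m - 2)" R])
    show "real_polynomial_function (\<lambda>z. t 0 z - (m - 2))"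
      by (intro real_polynomial_function_diff poly real_polynomial_function.intros(2))
    show "\<forall>z\<in>torus. 0 \<le> t 0 z - (m - 2) \<and> t 0 z - (m - 2) \<le> R"
    proof
      fix z assume z: "z \<in> torus"
      show "0 \<le> t 0 z - (m - 2) \<and> t 0 z - (m - 2) \<le> R"
        using t_ge[OF z, of 0] t_le[OF z, of 0] upper[OF z] by (simp add: R_def)
    qed
  qed
  \<comment> \<open>The factor \<open>a0\<close> belongs to the exponent t 0 - (m - 2), shifted to
    be nonnegative; the scalar exp (m - 2) undoes the shift.\<close>
  define A where "A = rec_nat (\<lambda>z. complex_of_real (exp (m - 2)) * a0 z) (\<lambda>n g z. g z * a n z)"
  have A_0: "A 0 = (\<lambda>z. complex_of_real (exp (m - 2)) * a0 z)"
    and A_Suc: "A (Suc n) = (\<lambda>z. A n z * a n z)" for n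
    by (simp_all add: A_def)
  have A_Linf: "A n \<in> Linf haar" for n
  proof (induction n)
    case 0
    show ?case unfolding A_0 by (intro Linf_mult Linf_const a0)
  next
    case (Suc n)
    then show ?case unfolding A_Suc by (intro Linf_mult a_Linf)
  qed
  \<comment> \<open>Writing g b as g + (b - 1) g reduces this to the multiplier b - 1.\<close>
  have step: "Spec (\<lambda>z. g z * b z) \<subseteq> P"
    if g: "g \<in> Linf haar" "Spec g \<subseteq> P" and b: "(\<lambda>z. b z - 1) \<in> multiplier P P'" for g b
  proof -
    have "(\<lambda>z. (b z - 1) * g z) \<in> Linf haar"
      by (intro Linf_mult multiplier_Linf[OF b] g)
    then have "Spec (\<lambda>z. g z + (b z - 1) * g z) \<subseteq> Spec g \<union> Spec (\<lambda>z. (b z - 1) * g z)"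
      by (rule Spec_add[OF g(1)])
    also have "\<dots> \<subseteq> P"
      using multiplier_Spec_mult[OF b g] g(2) by blast
    finally show ?thesis
      by (simp add: algebra_simps)
  qed
  have A_Spec: "Spec (A n) \<subseteq> P" for n
  proof (induction n)
    case 0
    show ?case
      unfolding A_0 using Spec_const zero_mem by (intro step Linf_const a0) blast
  next
    case (Suc n)
    then show ?case
      unfolding A_Suc by (intro step A_Linf a_mult)
  qed
  have A_norm: "AE z in haar. norm (A n z) = exp (t n z)" for n
  proof (induction n)
    case 0
    show ?case
      using a0(3) by eventually_elim (simp add: A_0 norm_mult flip: exp_add)
  next
    case (Suc n)
    show ?case
      using Suc a_norm[of n] by eventually_elim (simp add: A_Suc norm_mult flip: exp_add)
  qed
  have A_bound: "AE z in haar. norm (A n z) \<le> exp M" for n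
    using A_norm[of n] AE_space
  proof eventually_elim
    case (elim z)
    then show ?case
      using order_trans[OF t_le[of z n] upper[of z]] by simp
  qed
  have A_meas [measurable]: "A n \<in> borel_measurable haar" for n
    by (rule Linf_measurable[OF A_Linf])
  define D where "D n z = A (Suc n) z - A n z" for n z
  have D_meas [measurable]: "D n \<in> borel_measurable haar" for n
    unfolding D_def by measurable
  \<comment> \<open>The 6 is 2 from the exponent 2 p times 3 from the integrals of
    \<open>h - t n\<close>; the exponentials bound |A n|^2 and exp (2 p).\<close>
  define C where "C = 6 * exp (2 * M) * exp (2 * R)"
  have D_int: "integrable haar (\<lambda>z. (norm (D n z))\<^sup>2)" for n
  proof (rule haar.integrable_const_bound[of _ "(2 * exp M)\<^sup>2"])
    show "AE z in haar. norm ((norm (D n z))\<^sup>2) \<le> (2 * exp M)\<^sup>2"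
      using A_bound[of n] A_bound[of "Suc n"]
    proof eventually_elim
      case (elim z)
      have "norm (D n z) \<le> 2 * exp M"
        unfolding D_def using elim by (intro order_trans[OF norm_triangle_ineq4]) simp
      then have "(norm (D n z))\<^sup>2 \<le> (2 * exp M)\<^sup>2"
        by (rule power_mono) simp
      then show ?case by simp
    qed
  qed measurable
  have D_le: "(LINT z|haar. (norm (D n z))\<^sup>2) \<le> C * (1/4) ^ n" for n
  proof -
    let ?p = "\<lambda>z. t (Suc n) z - t n z"
    have p: "0 \<le> ?p z" "?p z \<le> R" if "z \<in> torus" for z
      using mono[OF that, of n] t_ge[OF that, of n] t_le[OF that, of "Suc n"] upper[OF that]
      by (simp_all add: R_def)
    have a1_Linf: "(\<lambda>z. (a n z - 1) * cnj (a n z - 1)) \<in> Linf haar"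
      by (intro Linf_mult Linf_cnj multiplier_Linf[OF a_mult])
    have sq_int: "integrable haar (\<lambda>z. (norm (a n z - 1))\<^sup>2)"
    proof -
      have "norm (x * cnj x) = (norm x)\<^sup>2" for x
        by (simp add: norm_mult power2_eq_square)
      then show ?thesis
        using integrable_norm[OF integrable_Linf[OF a1_Linf]] by (simp only:)
    qed
    \<comment> \<open>The increment is at most \<open>h - t n\<close>, because
      \<open>t (Suc n)\<close> stays below \<open>h\<close>.\<close>
    have exp_le: "exp (2 * ?p z) - 1 \<le> 2 * exp (2 * R) * (h z - t n z)" if z: "z \<in> torus" for z
    proof -
      let ?x = "2 * ?p z"
      have "exp ?x - 1 \<le> ?x * exp ?x"
        by (rule exp_minus_one_le)
      also have "\<dots> \<le> (2 * (h z - t n z)) * exp (2 * R)"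
        using p[OF z] t_le[OF z, of "Suc n"] t_le[OF z, of n] by (intro mult_mono) simp_all
      finally show ?thesis
        by (simp add: algebra_simps)
    qed
    have ht_int: "integrable haar (\<lambda>z. h z - t n z)"
    proof (rule haar.integrable_const_bound[of _ R])
      show "AE z in haar. norm (h z - t n z) \<le> R"
      proof (rule AE_I2)
        fix z assume "z \<in> space haar"
        then have z: "z \<in> torus" by simp
        show "norm (h z - t n z) \<le> R"
          using t_le[OF z, of n] t_ge[OF z, of n] upper[OF z] by (simp add: R_def)
      qed
    qed (use h_meas in measurable)
    have exp_int: "integrable haar (\<lambda>z. exp (2 * ?p z) - 1)"
    proof (rule haar.integrable_const_bound[of _ "exp (2 * R)"])
      show "AE z in haar. norm (exp (2 * ?p z) - 1) \<le> exp (2 * R)"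
      proof (rule AE_I2)
        fix z assume "z \<in> space haar"
        then have "0 \<le> ?p z" "exp (2 * ?p z) \<le> exp (2 * R)"
          using p[of z] by simp_all
        moreover from this have "1 \<le> exp (2 * ?p z)"
          by simp
        ultimately show "norm (exp (2 * ?p z) - 1) \<le> exp (2 * R)"
          unfolding real_norm_def by linarith
      qed
    qed measurable
    have "(LINT z|haar. (norm (D n z))\<^sup>2) \<le> (LINT z|haar. exp (2 * M) * (norm (a n z - 1))\<^sup>2)"
    proof (rule integral_mono_AE[OF D_int])
      show "integrable haar (\<lambda>z. exp (2 * M) * (norm (a n z - 1))\<^sup>2)"
        using sq_int by simp
      show "AE z in haar. (norm (D n z))\<^sup>2 \<le> exp (2 * M) * (norm (a n z - 1))\<^sup>2"
        using A_bound[of n]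
      proof eventually_elim
        case (elim z)
        have "D n z = A n z * (a n z - 1)"
          by (simp add: D_def A_Suc algebra_simps)
        then have "(norm (D n z))\<^sup>2 = (norm (A n z))\<^sup>2 * (norm (a n z - 1))\<^sup>2"
          by (simp add: norm_mult power_mult_distrib)
        also have "\<dots> \<le> (exp M)\<^sup>2 * (norm (a n z - 1))\<^sup>2"
          using elim by (intro mult_right_mono power_mono) simp_all
        finally show ?case
          by (simp add: exp_double)
      qed
    qed
    also have "\<dots> = exp (2 * M) * (LINT z|haar. exp (2 * ?p z) - 1)"
    proof -
      have "(\<lambda>z. exp (2 * ?p z)) \<in> borel_measurable haar"
        by measurable
      from integral_sq_minus_1[OF a_Linf a_mult a_norm this] show ?thesis
        by simp
    qed
    also have "\<dots> \<le> exp (2 * M) * (LINT z|haar. 2 * exp (2 * R) * (h z - t n z))"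
      using exp_int ht_int exp_le by (intro mult_left_mono integral_mono) simp_all
    also have "\<dots> \<le> exp (2 * M) * (2 * exp (2 * R) * (3 * (1/4) ^ n))"
      unfolding integral_mult_right_zero using t_int[of n] by (intro mult_left_mono) simp_all
    finally show ?thesis
      by (simp add: C_def)
  qed
  \<comment> \<open>The decay 4^(-n) leaves room for the weight 2^n, which is then traded for
    summability of |D n| itself.\<close>
  have "AE z in haar. summable (\<lambda>n. 2 ^ n * (norm (D n z))\<^sup>2)"
  proof (rule AE_summable_of_summable_integral)
    show "integrable haar (\<lambda>z. 2 ^ n * (norm (D n z))\<^sup>2)" for n
      using D_int by simp
    show "summable (\<lambda>n. LINT z|haar. 2 ^ n * (norm (D n z))\<^sup>2)"
    proof (rule summable_comparison_test')
      show "summable (\<lambda>n. C * (1/2 :: real) ^ n)"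
        by (intro summable_mult summable_geometric) simp
      show "norm (LINT z|haar. 2 ^ n * (norm (D n z))\<^sup>2) \<le> C * (1/2) ^ n" for n
      proof -
        have "2 ^ n * (LINT z|haar. (norm (D n z))\<^sup>2) \<le> 2 ^ n * (C * (1/4) ^ n)"
          by (intro mult_left_mono D_le) simp
        also have "\<dots> = C * (2 * (1/4)) ^ n"
          unfolding power_mult_distrib by simp
        finally show ?thesis
          by simp
      qed
    qed
  qed simp
  then have conv: "AE z in haar. (\<lambda>n. A n z) \<longlonglongrightarrow> lim (\<lambda>n. A n z)"
  proof eventually_elim
    case (elim z)
    have "summable (\<lambda>n. D n z)"
    proof (rule summable_comparison_test')
      show "summable (\<lambda>n. 2 ^ n * (norm (D n z))\<^sup>2 + (1/2) ^ n)"
        by (intro summable_add elim summable_geometric) simp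
      show "norm (D n z) \<le> 2 ^ n * (norm (D n z))\<^sup>2 + (1/2) ^ n" for n
      proof -
        let ?x = "2 ^ n * norm (D n z)"
        \<comment> \<open>Divided by 2^n, this bounds |D n| by the weighted square plus a term of a
          geometric series.\<close>
        have "?x \<le> ?x\<^sup>2 + 1"
          using zero_le_power2[of "?x - 1/2"] by (simp add: power2_eq_square algebra_simps)
        then have "(1/2) ^ n * ?x \<le> (1/2) ^ n * (?x\<^sup>2 + 1)"
          by (intro mult_left_mono) simp_all
        then show ?thesis
          by (simp add: power_mult_distrib power2_eq_square power_one_over algebra_simps)
      qed
    qed
    then have "(\<lambda>n. A 0 z + (\<Sum>i<n. D i z)) \<longlonglongrightarrow> A 0 z + (\<Sum>i. D i z)"
      by (intro tendsto_add tendsto_const summable_LIMSEQ)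
    moreover have "A 0 z + (\<Sum>i<n. D i z) = A n z" for n
      using sum_lessThan_telescope[of "\<lambda>i. A i z" n] by (simp add: D_def)
    ultimately have "convergent (\<lambda>n. A n z)"
      unfolding convergent_def by auto
    then show ?case
      by (simp add: convergent_LIMSEQ_iff)
  qed
  have lim_meas: "(\<lambda>z. lim (\<lambda>n. A n z)) \<in> borel_measurable haar"
    by measurable
  have "AE z in haar. \<forall>n. norm (A n z) = exp (t n z)"
    using A_norm by (simp add: AE_all_countable)
  then have "AE z in haar. norm (lim (\<lambda>n. A n z)) = exp (h z)"
    using conv AE_space
  proof eventually_elim
    case (elim z)
    have "(\<lambda>n. norm (A n z)) \<longlonglongrightarrow> exp (h z)"
      using tendsto_exp[OF t_lim[of z]] elim by simp
    then show ?case
      using tendsto_norm[OF elim(2)] LIMSEQ_unique by blast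
  qed
  moreover have "(\<lambda>z. lim (\<lambda>n. A n z)) \<in> Linf haar"
    by (rule Linf_bounded_limit(1)[OF A_Linf A_bound conv lim_meas])
  moreover have "Spec (\<lambda>z. lim (\<lambda>n. A n z)) \<subseteq> P"
    by (rule Spec_bounded_limit[OF A_Linf A_bound conv lim_meas A_Spec])
  ultimately show ?thesis
    by (intro that)
qed

end

section \<open>Sides of a convex polygon\<close>

definition cross2 :: "real \<times> real \<Rightarrow> real \<times> real \<Rightarrow> real" where
  "cross2 u v = fst u * snd v - snd u * fst v"

lemma cross2_linear:
  "cross2 (u + v) w = cross2 u w + cross2 v w"
  "cross2 u (v + w) = cross2 u v + cross2 u w"
  "cross2 (u - v) w = cross2 u w - cross2 v w"
  "cross2 u (v - w) = cross2 u v - cross2 u w"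
  "cross2 (c *\<^sub>R u) w = c * cross2 u w"
  "cross2 u (c *\<^sub>R w) = c * cross2 u w"
  "cross2 (- u) w = - cross2 u w"
  "cross2 u (- w) = - cross2 u w"
  by (simp_all add: cross2_def algebra_simps)

lemma cross2_self [simp]: "cross2 u u = 0"
  by (simp add: cross2_def)

lemma cross2_commute: "cross2 u v = - cross2 v u"
  by (simp add: cross2_def)

lemma cross2_zero [simp]: "cross2 0 u = 0" "cross2 u 0 = 0"
  by (simp_all add: cross2_def)

lemma cross2_cramer: "cross2 p q *\<^sub>R y = cross2 y q *\<^sub>R p + cross2 p y *\<^sub>R q"
  by (cases p, cases q, cases y) (simp add: cross2_def algebra_simps)

text \<open>In the plane the functionals vanishing on \<open>u\<close> form a line, spanned by
  \<open>cross2 u\<close>. The factor is the value of \<open>a\<close> at \<open>u\<close> turned by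
  a right angle, divided by |u|^2.\<close>

lemma orthogonal_imp_cross2_multiple:
  fixes a u :: "real \<times> real"
  assumes "a \<bullet> u = 0" "u \<noteq> 0"
  shows "\<exists>c. \<forall>x. a \<bullet> x = c * cross2 u x"
proof -
  define d where "d = (fst u)\<^sup>2 + (snd u)\<^sup>2"
  have d: "d \<noteq> 0"
    using assms(2) by (cases u) (simp add: d_def sum_power2_eq_zero_iff zero_prod_def)
  have o: "fst a * fst u = - (snd a * snd u)"
    using assms(1) by (simp add: inner_prod_def)
  show ?thesis
  proof (intro exI[of _ "(snd a * fst u - fst a * snd u) / d"] allI)
    fix x
    have "(a \<bullet> x) * d = (snd a * fst u - fst a * snd u) * cross2 u x"
      using o unfolding inner_prod_def inner_real_def cross2_def d_def by algebra
    then show "a \<bullet> x = (snd a * fst u - fst a * snd u) / d * cross2 u x"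
      using d by (simp add: field_simps)
  qed
qed

lemma cross2_zero_imp_parallel:
  assumes "cross2 u y = 0" "u \<noteq> 0"
  obtains c where "y = c *\<^sub>R u"
proof -
  \<comment> \<open>\<open>u\<close> turned by a right angle, which completes it to a basis.\<close>
  define v where "v = (- snd u, fst u)"
  have "cross2 u v = (fst u)\<^sup>2 + (snd u)\<^sup>2"
    by (simp add: v_def cross2_def power2_eq_square)
  then have "cross2 u v \<noteq> 0"
    using assms(2) by (cases u) (simp add: sum_power2_eq_zero_iff zero_prod_def)
  moreover have "cross2 u v *\<^sub>R y = cross2 y v *\<^sub>R u"
    using cross2_cramer[of u v y] assms(1) by simp
  ultimately have "y = (cross2 y v / cross2 u v) *\<^sub>R u"
    by (metis divide_inverse_commute inverse_eq_divide scaleR_scaleR scaleR_one left_inverse)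
  then show ?thesis by (rule that)
qed

lemma cross2_nonzero_imp_independent:
  assumes "cross2 u v \<noteq> 0"
  shows "u \<noteq> v \<and> independent {u, v}"
proof -
  have "v \<noteq> 0" "u \<noteq> v"
    using assms by auto
  moreover have "u \<notin> span {v}"
    using assms by (auto simp: span_singleton cross2_linear)
  ultimately show ?thesis
    by (simp add: independent_insert)
qed

lemma inner_eq_cross2:
  "(snd u, - fst u) \<bullet> x = - cross2 u x" for u x :: "real \<times> real"
  by (simp add: inner_prod_def cross2_def)

section \<open>The inner side of each edge, with indices modulo the number of vertices\<close>

locale polygon_vertices =
  fixes As :: "(nat \<times> nat) list"
  assumes polygon: "convex_polygon As"
begin

abbreviation "m \<equiv> length As"
abbreviation "V \<equiv> vertex As"

definition edge :: "nat \<Rightarrow> real \<times> real" where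
  "edge i = V (Suc i) - V i"

lemma m_ge_3: "3 \<le> m"
  using polygon by (simp add: convex_polygon_def)

lemma mod_m_less: "i mod m < m"
  using m_ge_3 by (intro mod_less_divisor) linarith

lemma vertex_mod: "V (i mod m) = V i"
  by (simp add: vertex_def)

lemma vertex_cong: "i mod m = k mod m \<Longrightarrow> V i = V k"
  by (simp add: vertex_def)

lemma vertex_eq_iff: "V i = V k \<longleftrightarrow> i mod m = k mod m"
proof
  assume "V i = V k"
  then have "As ! (i mod m) = As ! (k mod m)"
    by (simp add: vertex_def Let_def prod_eq_iff)
  moreover have "distinct As"
    using polygon by (simp add: convex_polygon_def)
  ultimately show "i mod m = k mod m"
    by (simp add: nth_eq_iff_index_eq mod_m_less)
qed (rule vertex_cong)

lemma Suc_mod_neq: "Suc i mod m \<noteq> i mod m"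
  using m_ge_3 by (auto simp: mod_Suc)

lemma Suc_Suc_mod_neq: "Suc (Suc i) mod m \<noteq> i mod m"
  using m_ge_3 by (auto simp: mod_Suc)

lemma edge_nonzero: "edge i \<noteq> 0"
  using Suc_mod_neq[of i] vertex_eq_iff[of "Suc i" i] by (simp add: edge_def)

lemma edge_cong:
  assumes "i mod m = k mod m"
  shows "edge i = edge k"
proof -
  have "Suc i mod m = Suc k mod m"
    using assms by (metis mod_Suc_eq)
  then show ?thesis
    using vertex_cong[OF assms] vertex_cong[of "Suc i" "Suc k"] by (simp add: edge_def)
qed

lemma vertex_in_polygon: "V k \<in> polygon As"
proof -
  have "V (k mod m) \<in> polygon As"
    unfolding polygon_def using mod_m_less by (intro hull_inc imageI) simp
  then show ?thesis
    by (simp only: vertex_mod)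
qed

text \<open>Faces of a polytope are exposed, so some linear functional is maximal exactly on the
  side; being constant there, it is a multiple of \<open>cross2 (edge i)\<close>. The other vertices
  are extreme points, hence off the side, which gives strictness. The sign \<open>s\<close> is left
  open because the vertices may be listed in either direction.\<close>

lemma supporting_side:
  "\<exists>s. (s = 1 \<or> s = -1) \<and>
     (\<forall>k. k mod m \<noteq> i mod m \<longrightarrow> k mod m \<noteq> Suc i mod m \<longrightarrow> 0 < s * cross2 (edge i) (V k - V i))"
proof -
  define j where "j = i mod m"
  have j: "j < m"
    unfolding j_def by (rule mod_m_less)
  have Vj: "V j = V i" "V (Suc j) = V (Suc i)"
    by (auto simp: j_def mod_Suc_eq intro!: vertex_cong)
  have face: "closed_segment (V i) (V (Suc i)) face_of polygon As"
    using polygon j unfolding convex_polygon_def Vj[symmetric] edge_of_def by blast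
  moreover have "polyhedron (polygon As)"
    unfolding polygon_def by (rule polyhedron_convex_hull) simp
  ultimately have "closed_segment (V i) (V (Suc i)) exposed_face_of polygon As"
    by (simp add: exposed_face_of_polyhedron)
  then obtain a b where le: "polygon As \<subseteq> {x. a \<bullet> x \<le> b}"
    and eq: "closed_segment (V i) (V (Suc i)) = polygon As \<inter> {x. a \<bullet> x = b}"
    unfolding exposed_face_of_def by (elim conjE exE)
  have ends: "a \<bullet> V i = b" "a \<bullet> V (Suc i) = b"
    using eq ends_in_segment[of "V i" "V (Suc i)"] by blast+
  have strict: "a \<bullet> V k < b" if k: "k mod m \<noteq> i mod m" "k mod m \<noteq> Suc i mod m" for k
  proof -
    have "V (k mod m) extreme_point_of polygon As"
      using polygon mod_m_less[of k] unfolding convex_polygon_def by blast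
    then have "V k extreme_point_of polygon As"
      by (simp only: vertex_mod)
    then have "V k \<notin> closed_segment (V i) (V (Suc i))"
      using k vertex_eq_iff extreme_point_of_face[OF face, of "V k"] extreme_point_of_segment[of "V k"]
      by simp
    then have "a \<bullet> V k \<noteq> b"
      using eq vertex_in_polygon[of k] by simp
    moreover have "a \<bullet> V k \<le> b"
      using le vertex_in_polygon[of k] by blast
    ultimately show ?thesis by simp
  qed
  have "a \<bullet> edge i = 0"
    using ends by (simp add: edge_def inner_diff_right)
  then obtain c where c: "\<And>x. a \<bullet> x = c * cross2 (edge i) x"
    using orthogonal_imp_cross2_multiple[OF _ edge_nonzero] by blast
  have neg: "c * cross2 (edge i) (V k - V i) < 0" if "k mod m \<noteq> i mod m" "k mod m \<noteq> Suc i mod m" for k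
    using strict[OF that] ends unfolding c[symmetric] by (simp add: inner_diff_right)
  show ?thesis
  proof (cases "c < 0")
    case True
    then show ?thesis
      using neg by (intro exI[of _ 1]) (auto simp: mult_less_0_iff)
  next
    case False
    then show ?thesis
      using neg by (intro exI[of _ "-1"]) (fastforce simp: mult_less_0_iff)
  qed
qed

lemma cross2_edges: "cross2 (edge (Suc i)) (V i - V (Suc i)) = cross2 (edge i) (V (Suc (Suc i)) - V i)"
  by (simp add: edge_def cross2_def algebra_simps)

text \<open>Two consecutive sides see the triangle of their three vertices with the same orientation,
  so the sign of \<open>s\<close> above does not depend on the side.\<close>

lemma orientation:
  "\<exists>s. (s = 1 \<or> s = -1) \<and>
     (\<forall>i k. k mod m \<noteq> i mod m \<longrightarrow> k mod m \<noteq> Suc i mod m \<longrightarrow> 0 < s * cross2 (edge i) (V k - V i))"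
proof -
  obtain s where s: "s 0 = 1 \<or> s 0 = (-1 :: real)"
    and pm: "\<And>i. s i = 1 \<or> s i = (-1 :: real)"
    and pos: "\<And>i k. k mod m \<noteq> i mod m \<Longrightarrow> k mod m \<noteq> Suc i mod m \<Longrightarrow> 0 < s i * cross2 (edge i) (V k - V i)"
    using supporting_side by metis
  have "s (Suc i) = s i" for i
  proof -
    have "0 < s i * cross2 (edge i) (V (Suc (Suc i)) - V i)"
      by (rule pos[OF Suc_Suc_mod_neq Suc_mod_neq])
    moreover have "0 < s (Suc i) * cross2 (edge (Suc i)) (V i - V (Suc i))"
      by (rule pos[OF Suc_mod_neq[symmetric] Suc_Suc_mod_neq[symmetric]])
    ultimately show ?thesis
      unfolding cross2_edges using pm[of i] pm[of "Suc i"] by (auto simp: zero_less_mult_iff)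
  qed
  then have "s i = s 0" for i
    by (induction i) simp_all
  then show ?thesis
    using s pos by (intro exI[of _ "s 0"]) metis
qed

text \<open>1 for a counterclockwise listing of the vertices, -1 for a clockwise one.\<close>

definition orient :: real where
  "orient = (SOME s. (s = 1 \<or> s = -1) \<and>
     (\<forall>i k. k mod m \<noteq> i mod m \<longrightarrow> k mod m \<noteq> Suc i mod m \<longrightarrow> 0 < s * cross2 (edge i) (V k - V i)))"

text \<open>Inner normal coordinate of side \<open>i\<close> up to a positive factor: nonnegative on
  directions pointing to the side of the polygon, whatever the direction of listing.\<close>

definition turn :: "nat \<Rightarrow> real \<times> real \<Rightarrow> real" where
  "turn i x = orient * cross2 (edge i) x"

lemma orient_cases: "orient = 1 \<or> orient = -1"
  and turn_pos: "k mod m \<noteq> i mod m \<Longrightarrow> k mod m \<noteq> Suc i mod m \<Longrightarrow> 0 < turn i (V k - V i)"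
  unfolding turn_def using someI_ex[OF orientation] unfolding orient_def[symmetric] by blast+

lemma turn_linear:
  "turn i (x + y) = turn i x + turn i y"
  "turn i (x - y) = turn i x - turn i y"
  "turn i (c *\<^sub>R x) = c * turn i x"
  "turn i (- x) = - turn i x"
  by (simp_all add: turn_def cross2_linear algebra_simps)

lemma turn_edge: "turn i (edge i) = 0"
  by (simp add: turn_def)

lemma turn_zero: "turn i 0 = 0"
  by (simp add: turn_def)

lemma turn_nonneg: "0 \<le> turn i (V k - V i)"
proof -
  consider "k mod m = i mod m" | "k mod m = Suc i mod m"
    | "k mod m \<noteq> i mod m" "k mod m \<noteq> Suc i mod m"
    by blast
  then show ?thesis
  proof cases
    case 1
    then show ?thesis using vertex_cong[of k i] by (simp add: turn_zero)
  next
    case 2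
    then have "V k - V i = edge i"
      using vertex_cong[of k "Suc i"] by (simp add: edge_def)
    then show ?thesis by (simp add: turn_edge)
  next
    case 3
    then show ?thesis using turn_pos by (simp add: less_imp_le)
  qed
qed

lemma polygon_turn_nonneg:
  assumes "x \<in> polygon As"
  shows "0 \<le> turn i (x - V i)"
proof -
  let ?H = "{x. turn i (V i) \<le> turn i x}"
  have "convex ?H"
    unfolding convex_alt
  proof (intro ballI allI impI)
    fix x y u assume "x \<in> ?H" "y \<in> ?H" and u: "0 \<le> (u::real) \<and> u \<le> 1"
    then have "(1 - u) * turn i (V i) + u * turn i (V i) \<le> (1 - u) * turn i x + u * turn i y"
      by (intro add_mono mult_left_mono) simp_all
    then show "(1 - u) *\<^sub>R x + u *\<^sub>R y \<in> ?H"
      by (simp add: turn_linear algebra_simps)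
  qed
  moreover have "V ` {..<m} \<subseteq> ?H"
    using turn_nonneg[of i] by (auto simp: turn_linear)
  ultimately have "polygon As \<subseteq> ?H"
    unfolding polygon_def by (rule hull_minimal[rotated])
  then show ?thesis
    using assms by (auto simp: turn_linear)
qed

text \<open>Every half-plane with this boundary line is described by a nonzero multiple of
  \<open>turn i\<close>; the vertex with index i + 2 lies strictly inside and fixes the sign. This
  is the uniqueness that \<open>THE\<close> requires.\<close>

lemma side_half_plane_eq: "side_half_plane As i = {x. 0 \<le> turn i (x - V i)}"
  unfolding side_half_plane_def
proof (rule the_equality, intro conjI)
  let ?a = "orient *\<^sub>R (snd (edge i), - fst (edge i))"
  have a: "?a \<bullet> x = - turn i x" for x
    unfolding inner_scaleR_left inner_eq_cross2 turn_def by simp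
  have "side_line As i = {x. ?a \<bullet> x = ?a \<bullet> V i}"
    unfolding a
  proof (intro equalityI subsetI)
    fix x assume "x \<in> side_line As i"
    then obtain u v where x: "x = u *\<^sub>R V i + v *\<^sub>R V (Suc i)" "u + v = 1"
      unfolding side_line_def affine_hull_2 by blast
    have "x - V i = v *\<^sub>R edge i"
      unfolding x(1) using x(2) by (simp add: edge_def algebra_simps flip: scaleR_add_left)
    then have "turn i (x - V i) = 0"
      by (simp add: turn_linear turn_edge)
    then show "x \<in> {x. - turn i x = - turn i (V i)}"
      by (simp add: turn_linear)
  next
    fix x assume "x \<in> {x. - turn i x = - turn i (V i)}"
    then have "turn i (x - V i) = 0"
      by (simp add: turn_linear)
    then have "cross2 (edge i) (x - V i) = 0"
      using orient_cases by (auto simp: turn_def)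
    then obtain c where "x - V i = c *\<^sub>R edge i"
      using edge_nonzero by (rule cross2_zero_imp_parallel)
    then have "x = (1 - c) *\<^sub>R V i + c *\<^sub>R V (Suc i)"
      by (simp add: edge_def algebra_simps)
    then show "x \<in> side_line As i"
      unfolding side_line_def affine_hull_2 by (intro CollectI exI[of _ "1 - c"] exI[of _ c]) simp
  qed
  moreover have "?a \<noteq> 0"
    using edge_nonzero[of i] orient_cases by (cases "edge i") (auto simp: zero_prod_def)
  moreover have "{x. 0 \<le> turn i (x - V i)} = {x. ?a \<bullet> x \<le> ?a \<bullet> V i}"
    unfolding a by (simp add: turn_linear)
  ultimately show "closed_half_plane_bounded_by (side_line As i) {x. 0 \<le> turn i (x - V i)}"
    unfolding closed_half_plane_bounded_by_def by blast
  show "polygon As \<subseteq> {x. 0 \<le> turn i (x - V i)}"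
    using polygon_turn_nonneg by blast
next
  fix H assume "closed_half_plane_bounded_by (side_line As i) H \<and> polygon As \<subseteq> H"
  then obtain a b where a: "a \<noteq> 0" "side_line As i = {x. a \<bullet> x = b}" "H = {x. a \<bullet> x \<le> b}"
    and sub: "polygon As \<subseteq> H"
    unfolding closed_half_plane_bounded_by_def by blast
  have "V i \<in> side_line As i" "V (Suc i) \<in> side_line As i"
    unfolding side_line_def by (simp_all add: hull_inc)
  then have ends: "a \<bullet> V i = b" "a \<bullet> V (Suc i) = b"
    unfolding a(2) by simp_all
  then have "a \<bullet> edge i = 0"
    by (simp add: edge_def inner_diff_right)
  then obtain c where c: "\<And>x. a \<bullet> x = c * cross2 (edge i) x"
    using orthogonal_imp_cross2_multiple[OF _ edge_nonzero] by blast
  define d where "d = c * orient"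
  have d: "a \<bullet> x - b = d * turn i (x - V i)" for x
    using ends(1) c[of "x - V i"] orient_cases by (auto simp: d_def turn_def inner_diff_right)
  have "c \<noteq> 0"
    using a(1) c[of a] by auto
  let ?k = "Suc (Suc i)"
  have "0 < turn i (V ?k - V i)"
    by (rule turn_pos[OF Suc_Suc_mod_neq Suc_mod_neq])
  moreover have "d * turn i (V ?k - V i) \<le> 0"
    unfolding d[symmetric] using sub a(3) vertex_in_polygon[of ?k] by auto
  moreover have "d \<noteq> 0"
    using \<open>c \<noteq> 0\<close> orient_cases by (auto simp: d_def)
  ultimately have "d < 0"
    by (auto simp: mult_le_0_iff)
  have "a \<bullet> x \<le> b \<longleftrightarrow> 0 \<le> turn i (x - V i)" for x
  proof -
    have "a \<bullet> x \<le> b \<longleftrightarrow> d * turn i (x - V i) \<le> 0"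
      unfolding d[symmetric] by simp
    also have "\<dots> \<longleftrightarrow> 0 \<le> turn i (x - V i)"
      using \<open>d < 0\<close> by (auto simp: mult_le_0_iff)
    finally show ?thesis .
  qed
  then show "H = {x. 0 \<le> turn i (x - V i)}"
    unfolding a(3) by simp
qed

lemma side_points0_eq: "side_points0 As i = {k. 0 \<le> turn i (lattice_pt k)}"
proof -
  have "y \<in> (\<lambda>x. x - V i) ` {x. 0 \<le> turn i (x - V i)} \<longleftrightarrow> 0 \<le> turn i y" for y
    by (auto intro!: image_eqI[of _ _ "y + V i"])
  then show ?thesis
    by (simp add: side_points0_def integer_points_def side_half_plane_eq)
qed

lemma vertex_half_cone0_eq:
  "vertex_half_cone0 As i = {y. 0 \<le> turn (i + m - 1) y \<and> 0 \<le> turn i y}"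
proof -
  let ?p = "i + m - 1"
  have "Suc ?p = i + m"
    using m_ge_3 by linarith
  then have "Suc ?p mod m = i mod m"
    by simp
  \<comment> \<open>The preceding side ends at \<open>V i\<close>, so its half-plane may be measured
    from \<open>V i\<close> as well.\<close>
  then have "V i - V ?p = edge ?p"
    using vertex_cong[of "Suc ?p" i] by (simp add: edge_def)
  then have "turn ?p (V i - V ?p) = 0"
    by (simp only: turn_edge)
  then have p: "turn ?p (x - V ?p) = turn ?p (x - V i)" for x
    by (simp add: turn_linear)
  have "y \<in> (\<lambda>x. x - V i) ` {x. 0 \<le> turn ?p (x - V i) \<and> 0 \<le> turn i (x - V i)} \<longleftrightarrow>
      0 \<le> turn ?p y \<and> 0 \<le> turn i y" for y
    by (auto intro!: image_eqI[of _ _ "y + V i"])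
  then show ?thesis
    unfolding vertex_half_cone0_def vertex_half_cone_def side_half_plane_eq p Collect_conj_eq[symmetric]
    by blast
qed

text \<open>By Cramer's rule the polygon lies in the cone spanned at a vertex by the two adjacent sides.\<close>

lemma local_min_imp_global_min:
  assumes "0 < cross2 (V i - V (Suc i)) e" "0 < cross2 (V (Suc (Suc i)) - V (Suc i)) e"
    and k: "k mod m \<noteq> Suc i mod m"
  shows "0 < cross2 (V k - V (Suc i)) e"
proof -
  let ?p = "V i - V (Suc i)" and ?q = "V (Suc (Suc i)) - V (Suc i)" and ?y = "V k - V (Suc i)"
  \<comment> \<open>Cramer's determinants, with the sign that turns them into values of
    \<open>turn\<close>: for side \<open>i\<close> in \<open>w\<close> and \<gamma>, for side
    \<open>Suc i\<close> in \<beta>.\<close>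
  define w where "w = - orient * cross2 ?p ?q"
  define \<beta> where "\<beta> = - orient * cross2 ?y ?q"
  define \<gamma> where "\<gamma> = - orient * cross2 ?p ?y"
  have shift: "turn i (V l - V i) = turn i (V l - V (Suc i))" for l
    using turn_linear(1)[of i "V l - V (Suc i)" "edge i"] by (simp add: turn_edge) (simp add: edge_def)
  have w: "w = turn i (V (Suc (Suc i)) - V i)" and \<gamma>: "\<gamma> = turn i (V k - V i)"
    unfolding shift by (simp_all add: w_def \<gamma>_def turn_def edge_def cross2_def algebra_simps)
  have \<beta>: "\<beta> = turn (Suc i) (V k - V (Suc i))"
    by (simp add: \<beta>_def turn_def edge_def cross2_def algebra_simps)
  have "0 < w"
    unfolding w by (rule turn_pos[OF Suc_Suc_mod_neq Suc_mod_neq])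
  have nonneg: "0 \<le> \<beta>" "0 \<le> \<gamma>"
    unfolding \<beta> \<gamma> by (rule turn_nonneg)+
  have "0 < \<beta> \<or> 0 < \<gamma>"
  proof (cases "k mod m = Suc (Suc i) mod m")
    case True
    then have "0 < \<gamma>"
      unfolding \<gamma> by (intro turn_pos) (use Suc_Suc_mod_neq Suc_mod_neq in auto)
    then show ?thesis ..
  next
    case False
    then have "0 < \<beta>"
      unfolding \<beta> by (intro turn_pos k)
    then show ?thesis ..
  qed
  have "w *\<^sub>R ?y = \<beta> *\<^sub>R ?p + \<gamma> *\<^sub>R ?q"
    using arg_cong[OF cross2_cramer[of ?p ?q ?y], of "\<lambda>x. (- orient) *\<^sub>R x"]
    by (simp only: w_def \<beta>_def \<gamma>_def scaleR_add_right scaleR_scaleR)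
  from arg_cong[OF this, of "\<lambda>x. cross2 x e"]
  have "w * cross2 ?y e = \<beta> * cross2 ?p e + \<gamma> * cross2 ?q e"
    by (simp only: cross2_linear)
  also have "\<dots> > 0"
    using nonneg \<open>0 < \<beta> \<or> 0 < \<gamma>\<close> assms(1,2)
    by (metis add_nonneg_pos add_pos_nonneg less_imp_le mult_nonneg_nonneg mult_pos_pos)
  finally show ?thesis
    using \<open>0 < w\<close> by (simp add: zero_less_mult_iff)
qed

end

text \<open>The sequence rises from a global minimum \<open>r\<close> to a first descent
  \<open>b\<close>. A later ascent would create a local minimum, which by \<open>local_min\<close>
  would lie strictly below the value at \<open>r\<close>.\<close>

lemma cyclic_unimodal:
  fixes x :: "nat \<Rightarrow> real"
  assumes periodic: "\<And>i. x (i + m) = x i" and m: "0 < m" and ne: "\<And>i. x (Suc i) \<noteq> x i"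
    and local_min: "\<And>i k. x (Suc i) < x i \<Longrightarrow> x (Suc i) < x (Suc (Suc i)) \<Longrightarrow>
      k mod m \<noteq> Suc i mod m \<Longrightarrow> x (Suc i) < x k"
  shows "\<exists>r b. 0 < b \<and> b < m \<and> (\<forall>k<b. x (r + k) < x (Suc (r + k))) \<and>
    (\<forall>k. b \<le> k \<longrightarrow> k < m \<longrightarrow> x (Suc (r + k)) < x (r + k))"
proof -
  have mod: "x (i mod m) = x i" for i
  proof -
    have "x (i mod m + n * m) = x (i mod m)" for n
      by (induction n) (simp_all add: periodic add.assoc[symmetric] add.commute[of m])
    from this[of "i div m"] show ?thesis by simp
  qed
  have "finite (x ` {..<m})" "x ` {..<m} \<noteq> {}"
    using m by auto
  from Min_in[OF this] obtain r where r: "x r = Min (x ` {..<m})"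
    by auto
  have min: "x r \<le> x i" for i
    unfolding r mod[of i, symmetric] using m by (intro Min_le) auto
  \<comment> \<open>Otherwise the sequence would increase strictly over a whole period.\<close>
  have "\<exists>b. x (Suc (r + b)) < x (r + b)"
  proof (rule ccontr)
    assume "\<not> ?thesis"
    then have "x (r + k) < x (r + Suc k)" for k
      using ne[of "r + k"] by (metis add_Suc_right linorder_neqE_linordered_idom)
    then have "x (r + 0) < x (r + m)"
      using m by (rule lift_Suc_mono_less)
    then show False
      by (simp add: periodic)
  qed
  then obtain b where b: "x (Suc (r + b)) < x (r + b)"
    and least: "\<And>k. k < b \<Longrightarrow> \<not> x (Suc (r + k)) < x (r + k)"
    using exists_least_iff[of "\<lambda>b. x (Suc (r + b)) < x (r + b)"] by blast
  have up: "x (r + k) < x (Suc (r + k))" if "k < b" for k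
    using least[OF that] ne[of "r + k"] by simp
  have "0 < b"
    using b min[of "Suc r"] by (cases "b = 0") auto
  have "b < m"
  proof (rule ccontr)
    assume "\<not> b < m"
    have "k \<le> b \<Longrightarrow> 0 < k \<Longrightarrow> x r < x (r + k)" for k
    proof (induction k)
      case (Suc k)
      then show ?case
        using up[of k] min[of "r + k"] by simp
    qed simp
    from this[of m] show False
      using \<open>\<not> b < m\<close> m by (simp add: periodic)
  qed
  have down: "x (Suc (r + k)) < x (r + k)" if "b \<le> k" "k < m" for k
    using that
  proof (induction k rule: dec_induct)
    case base
    then show ?case using b by simp
  next
    case (step k)
    then have prev: "x (Suc (r + k)) < x (r + k)"
      by simp
    show ?case
    proof (rule ccontr)
      assume "\<not> ?case"
      then have "x (Suc (r + k)) < x (Suc (Suc (r + k)))"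
        using ne[of "Suc (r + k)"] by simp
      \<comment> \<open>As Suc k < m, the new local minimum sits at another position of the cycle
        than \<open>r\<close>.\<close>
      moreover have "r mod m \<noteq> Suc (r + k) mod m"
      proof
        assume "r mod m = Suc (r + k) mod m"
        then have "m dvd Suc (r + k) - r"
          by (subst (asm) eq_commute) (simp add: mod_eq_dvd_iff_nat)
        then show False
          using step.prems by (auto dest: dvd_imp_le)
      qed
      ultimately have "x (Suc (r + k)) < x r"
        using local_min[OF prev] by blast
      then show False
        using min[of "Suc (r + k)"] by simp
    qed
  qed
  show ?thesis
    using \<open>0 < b\<close> \<open>b < m\<close> up down by (intro exI[of _ r] exI[of _ b]) simp
qed

section \<open>Thin cones and the factorization\<close>

lemma lattice_pt_add: "lattice_pt (k + l) = lattice_pt k + lattice_pt l"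
  by (simp add: lattice_pt_def)

lemma lattice_pt_diff: "lattice_pt (k - l) = lattice_pt k - lattice_pt l"
  by (simp add: lattice_pt_def)

lemma lattice_pt_uminus: "lattice_pt (- k) = - lattice_pt k"
  by (simp add: lattice_pt_def)

lemma lattice_pt_scale: "lattice_pt (n * fst k, n * snd k) = of_int n *\<^sub>R lattice_pt k"
  by (simp add: lattice_pt_def)

lemma lattice_pt_zero_iff: "lattice_pt k = 0 \<longleftrightarrow> k = 0"
  by (cases k) (simp add: lattice_pt_def zero_prod_def)

definition cone2 :: "real \<times> real \<Rightarrow> real \<times> real \<Rightarrow> (real \<times> real) set" where
  "cone2 u v = {s *\<^sub>R u + t *\<^sub>R v | s t. 0 \<le> s \<and> 0 \<le> t}"

text \<open>The lattice point \<open>e\<close> is interior, so a large multiple of it pushes any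
  finite set into the cone. Pointedness comes from the independence of \<open>u\<close> and
  \<open>v\<close>.\<close>

lemma deep_cone_integer_points:
  assumes uv: "cross2 u v \<noteq> 0" and e: "lattice_pt e = p *\<^sub>R u + q *\<^sub>R v" and pq: "0 < p" "0 < q"
  shows "deep_cone (integer_points (cone2 u v))"
proof
  show "0 \<in> integer_points (cone2 u v)"
    unfolding integer_points_def cone2_def
    by (auto simp: lattice_pt_zero_iff[THEN iffD2] intro!: exI[of _ 0])
next
  fix k l assume "k \<in> integer_points (cone2 u v)" "l \<in> integer_points (cone2 u v)"
  then obtain s t s' t' where nonneg: "0 \<le> s" "0 \<le> t" "0 \<le> s'" "0 \<le> t'"
    and "lattice_pt k = s *\<^sub>R u + t *\<^sub>R v" "lattice_pt l = s' *\<^sub>R u + t' *\<^sub>R v"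
    unfolding integer_points_def cone2_def by blast
  then have "lattice_pt (k + l) = (s + s') *\<^sub>R u + (t + t') *\<^sub>R v"
    by (simp add: lattice_pt_add algebra_simps)
  moreover have "0 \<le> s + s'" "0 \<le> t + t'"
    using nonneg by simp_all
  ultimately show "k + l \<in> integer_points (cone2 u v)"
    unfolding integer_points_def cone2_def by blast
next
  fix k assume "k \<in> integer_points (cone2 u v)" "- k \<in> integer_points (cone2 u v)"
  then obtain s t s' t' where nonneg: "0 \<le> s" "0 \<le> t" "0 \<le> s'" "0 \<le> t'"
    and k: "lattice_pt k = s *\<^sub>R u + t *\<^sub>R v" "lattice_pt (- k) = s' *\<^sub>R u + t' *\<^sub>R v"
    unfolding integer_points_def cone2_def by blast
  have "(s + s') *\<^sub>R u + (t + t') *\<^sub>R v = lattice_pt k + lattice_pt (- k)"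
    unfolding k by (simp add: algebra_simps)
  also have "\<dots> = 0"
    by (simp add: lattice_pt_uminus)
  finally have *: "(s + s') *\<^sub>R u + (t + t') *\<^sub>R v = 0" .
  have "(s + s') * cross2 u v = 0"
    using arg_cong[OF *, of "\<lambda>y. cross2 y v"] by (simp add: cross2_linear)
  moreover have "(t + t') * cross2 u v = 0"
    using arg_cong[OF *, of "cross2 u"] by (simp add: cross2_linear)
  ultimately have "s = 0" "t = 0"
    using uv nonneg by auto
  then show "k = 0"
    using k(1) by (simp add: lattice_pt_zero_iff)
next
  fix F :: "(int \<times> int) set" assume F: "finite F"
  define S where "S y = cross2 y v / cross2 u v" for y
  define T where "T y = cross2 u y / cross2 u v" for y
  have decomp: "y = S y *\<^sub>R u + T y *\<^sub>R v" for y
  proof -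
    have "cross2 u v *\<^sub>R y = cross2 u v *\<^sub>R (S y *\<^sub>R u + T y *\<^sub>R v)"
      using uv cross2_cramer[of u v y] by (simp add: S_def T_def scaleR_add_right)
    then show ?thesis
      using uv by simp
  qed
  have S_e: "S (y + c *\<^sub>R lattice_pt e) = S y + c * p" and T_e: "T (y + c *\<^sub>R lattice_pt e) = T y + c * q" for y c
    using uv by (simp_all add: S_def T_def e cross2_linear add_divide_distrib)
  \<comment> \<open>Both coordinates of k + n e are positive once n exceeds \<open>b k\<close>; the
    sum over \<open>F\<close> serves as a common bound.\<close>
  define b where "b k = \<bar>S (lattice_pt k)\<bar> / p + \<bar>T (lattice_pt k)\<bar> / q" for k
  have b_nonneg: "0 \<le> b k" for k
    using pq by (simp add: b_def)
  obtain n :: nat where n: "(\<Sum>k\<in>F. b k) < real n"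
    using reals_Archimedean2 by blast
  show "\<exists>k. \<forall>l\<in>F. l + k \<in> integer_points (cone2 u v) - {0}"
  proof (intro exI ballI)
    fix l assume l: "l \<in> F"
    let ?x = "l + (int n * fst e, int n * snd e)"
    have x: "lattice_pt ?x = lattice_pt l + real n *\<^sub>R lattice_pt e"
      by (simp add: lattice_pt_add lattice_pt_scale)
    have "b l < real n"
      using member_le_sum[of l F b] b_nonneg l F n by simp
    moreover have "0 \<le> \<bar>S (lattice_pt l)\<bar> / p" "0 \<le> \<bar>T (lattice_pt l)\<bar> / q"
      using pq by simp_all
    ultimately have "\<bar>S (lattice_pt l)\<bar> / p < real n" "\<bar>T (lattice_pt l)\<bar> / q < real n"
      unfolding b_def by linarith+
    then have "\<bar>S (lattice_pt l)\<bar> < real n * p" "\<bar>T (lattice_pt l)\<bar> < real n * q"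
      using pq by (simp_all add: divide_less_eq)
    then have pos: "0 < S (lattice_pt ?x)" "0 < T (lattice_pt ?x)"
      unfolding x S_e T_e by linarith+
    then have "lattice_pt ?x \<in> cone2 u v"
      using decomp[of "lattice_pt ?x"] less_imp_le unfolding cone2_def by blast
    moreover have "?x \<noteq> 0"
    proof
      assume "?x = 0"
      then have "lattice_pt ?x = 0"
        by (simp only: lattice_pt_zero_iff)
      with pos(1) show False
        by (simp add: S_def)
    qed
    ultimately show "?x \<in> integer_points (cone2 u v) - {0}"
      unfolding integer_points_def by blast
  qed
qed

context polygon_vertices
begin

lemma turn_mod: "turn (i mod m) = turn i"
  unfolding turn_def using edge_cong[of "i mod m" i] by simp

lemma vertex_lattice: "\<exists>k. V i = lattice_pt k"
  by (intro exI[of _ "(int (fst (As ! (i mod m))), int (snd (As ! (i mod m))))"])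
    (simp add: vertex_def lattice_pt_def Let_def)

text \<open>With a and b the two side vectors leaving vertex \<open>j\<close>, every a + t b with t
  > 0 is interior to the cone at \<open>j\<close>, and each side is parallel to at most one of these
  vectors. So finitely many natural numbers t are excluded, and integer vertices make the direction
  a lattice vector.\<close>

lemma generic_direction:
  "\<exists>e. 0 < turn (j + m - 1) (lattice_pt e) \<and> 0 < turn j (lattice_pt e) \<and>
    (\<forall>i. turn i (lattice_pt e) \<noteq> 0)"
proof -
  let ?p = "j + m - 1"
  have "Suc ?p = j + m"
    using m_ge_3 by linarith
  then have p: "Suc ?p mod m = j mod m" "Suc (Suc ?p) mod m = Suc j mod m"
    using mod_Suc_eq[of "j + m" m] mod_Suc_eq[of j m] by simp_all
  obtain k0 k1 k2 where k: "V j = lattice_pt k0" "V (Suc j) = lattice_pt k1" "V ?p = lattice_pt k2"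
    using vertex_lattice by metis
  let ?a = "edge j" and ?b = "V ?p - V j"
  have edge_p: "edge ?p = - ?b"
    using vertex_cong[OF p(1)] by (simp add: edge_def)
  have b_pos: "0 < turn j ?b"
    by (rule turn_pos) (use p Suc_mod_neq[of ?p] Suc_Suc_mod_neq[of ?p] in auto)
  have "0 < turn ?p (V (Suc j) - V ?p)"
    by (rule turn_pos) (use p Suc_Suc_mod_neq[of ?p] Suc_mod_neq[of "Suc ?p"] in auto)
  moreover have "V (Suc j) - V ?p = ?a + edge ?p"
    unfolding edge_p by (simp add: edge_def)
  ultimately have a_pos: "0 < turn ?p ?a"
    by (simp only: turn_linear turn_edge)
  have b_p: "turn ?p ?b = 0"
    using turn_edge[of ?p] unfolding edge_p by (simp add: turn_linear)
  have cross_ab: "cross2 ?a ?b \<noteq> 0"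
    using b_pos by (auto simp: turn_def)
  define bad where "bad i = {t :: nat. turn i ?a + real t * turn i ?b = 0}" for i
  have "finite (bad i)" for i
  proof (cases "turn i ?b = 0")
    case True
    \<comment> \<open>Otherwise side \<open>i\<close> would be parallel to both of the independent
      vectors \<open>?a\<close> and \<open>?b\<close>.\<close>
    have "turn i ?a \<noteq> 0"
    proof
      assume "turn i ?a = 0"
      then have "cross2 (edge i) ?a = 0" "cross2 (edge i) ?b = 0"
        using True orient_cases by (auto simp: turn_def)
      then have "cross2 ?a ?b *\<^sub>R edge i = 0"
        using cross2_cramer[of ?a ?b "edge i"] cross2_commute[of ?a "edge i"] by simp
      then show False
        using cross_ab edge_nonzero by simp
    qed
    then show ?thesis
      using True by (simp add: bad_def)
  next
    case False
    then have "bad i \<subseteq> {t. real t = - turn i ?a / turn i ?b}"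
      by (auto simp: bad_def field_simps)
    \<comment> \<open>A natural number is recovered from its real value, so at most one t
      remains.\<close>
    also have "\<dots> \<subseteq> {nat \<lfloor>- turn i ?a / turn i ?b\<rfloor>}"
      by auto (metis floor_of_nat nat_int)
    finally show ?thesis
      by (rule finite_subset) simp
  qed
  then have "finite (insert 0 (\<Union>i<m. bad i))"
    by simp
  then obtain t where t: "t \<notin> insert 0 (\<Union>i<m. bad i)"
    using ex_new_if_finite infinite_UNIV_nat by blast
  define e where "e = (k1 - k0) + (int t * fst (k2 - k0), int t * snd (k2 - k0))"
  have e: "lattice_pt e = ?a + real t *\<^sub>R ?b"
    unfolding e_def lattice_pt_add lattice_pt_scale lattice_pt_diff edge_def k by simp
  have turn_e: "turn i (lattice_pt e) = turn i ?a + real t * turn i ?b" for i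
    unfolding e by (simp only: turn_linear)
  show ?thesis
  proof (intro exI conjI allI)
    show "0 < turn ?p (lattice_pt e)"
      unfolding turn_e b_p using a_pos by simp
    show "0 < turn j (lattice_pt e)"
      unfolding turn_e using b_pos t by (simp add: turn_edge)
    show "turn i (lattice_pt e) \<noteq> 0" for i
    proof -
      have "t \<notin> bad (i mod m)"
        using t mod_m_less[of i] by blast
      then show ?thesis
        unfolding turn_e bad_def by (simp add: turn_mod)
    qed
  qed
qed

text \<open>The generators are N d + d' and N d - d' with d' orthogonal to d. For large N the
  perturbation d' cannot reverse the sign of any \<open>turn i\<close>; the product in the
  conclusion treats both signs at once.\<close>

lemma thin_cone:
  assumes e: "\<And>i. turn i (lattice_pt e) \<noteq> 0"
  shows "\<exists>C. half_cone_of C (C \<union> uminus ` C) \<and> deep_cone (integer_points C) \<and>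
    (\<forall>i. \<forall>y\<in>C. 0 \<le> turn i (lattice_pt e) * turn i y)"
proof -
  define d where "d = lattice_pt e"
  define d' where "d' = (- snd d, fst d)"
  have "d \<noteq> 0"
    using e[of 0] by (auto simp: d_def turn_zero)
  then have dd': "cross2 d d' > 0"
    by (cases d) (simp add: d'_def cross2_def zero_prod_def sum_power2_gt_zero_iff flip: power2_eq_square)
  \<comment> \<open>A sum in place of the maximum over the sides; the summand 1 makes N
    positive.\<close>
  define N where "N = 1 + (\<Sum>i<m. \<bar>turn i d'\<bar> / \<bar>turn i d\<bar>)"
  have "0 \<le> (\<Sum>i<m. \<bar>turn i d'\<bar> / \<bar>turn i d\<bar>)"
    by (intro sum_nonneg) simp
  then have N: "0 < N"
    by (simp add: N_def)
  have bound: "\<bar>turn i d'\<bar> \<le> N * \<bar>turn i d\<bar>" for i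
  proof -
    have "\<bar>turn (i mod m) d'\<bar> / \<bar>turn (i mod m) d\<bar> \<le> (\<Sum>i<m. \<bar>turn i d'\<bar> / \<bar>turn i d\<bar>)"
      by (rule member_le_sum[of _ _ "\<lambda>i. \<bar>turn i d'\<bar> / \<bar>turn i d\<bar>"]) (use mod_m_less in auto)
    also have "\<dots> \<le> N"
      by (simp add: N_def)
    finally show ?thesis
      using e[of i] by (simp add: turn_mod d_def divide_le_eq)
  qed
  let ?u = "N *\<^sub>R d + d'" and ?v = "N *\<^sub>R d - d'"
  have "cross2 ?u ?v = - 2 * N * cross2 d d'"
    unfolding cross2_linear cross2_commute[of d' d] by simp
  then have uv: "cross2 ?u ?v \<noteq> 0"
    using N dd' by simp
  show ?thesis
  proof (intro exI[of _ "cone2 ?u ?v"] conjI allI ballI)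
    show "half_cone_of (cone2 ?u ?v) (cone2 ?u ?v \<union> uminus ` cone2 ?u ?v)"
      unfolding half_cone_of_def cone2_def using cross2_nonzero_imp_independent[OF uv] by blast
    have "lattice_pt e = (1 / (2 * N)) *\<^sub>R ?u + (1 / (2 * N)) *\<^sub>R ?v"
      using N by (simp add: d_def scaleR_add_right scaleR_diff_right flip: scaleR_add_left)
    then show "deep_cone (integer_points (cone2 ?u ?v))"
      by (rule deep_cone_integer_points[OF uv]) (use N in simp_all)
    fix i y assume "y \<in> cone2 ?u ?v"
    then obtain s t where st: "0 \<le> s" "0 \<le> t" and y: "y = s *\<^sub>R ?u + t *\<^sub>R ?v"
      unfolding cone2_def by blast
    have "\<bar>turn i d * turn i d'\<bar> \<le> \<bar>turn i d\<bar> * (N * \<bar>turn i d\<bar>)"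
      unfolding abs_mult by (intro mult_left_mono bound) simp
    also have "\<dots> = N * (\<bar>turn i d\<bar> * \<bar>turn i d\<bar>)"
      by (rule mult.left_commute)
    also have "\<dots> = N * (turn i d * turn i d)"
      by (simp only: abs_mult_self_eq)
    finally have "0 \<le> turn i d * turn i ?u" "0 \<le> turn i d * turn i ?v"
      unfolding turn_linear distrib_left right_diff_distrib mult.left_commute[of _ N] abs_le_iff by linarith+
    then have "0 \<le> s * (turn i d * turn i ?u) + t * (turn i d * turn i ?v)"
      using st by simp
    also have "\<dots> = turn i d * turn i y"
      unfolding y turn_linear by (simp add: algebra_simps)
    finally show "0 \<le> turn i (lattice_pt e) * turn i y"
      unfolding d_def .
  qed
qed

lemma turn_sign_change:
  assumes e: "\<And>i. turn i e \<noteq> 0"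
  shows "\<exists>r b. 0 < b \<and> b < m \<and> (\<forall>k<b. 0 < turn (r + k) e) \<and>
    (\<forall>k. b \<le> k \<longrightarrow> k < m \<longrightarrow> turn (r + k) e < 0)"
proof -
  \<comment> \<open>The increment of \<open>x\<close> along side \<open>i\<close> is
    \<open>turn i e\<close>, so the signs of \<open>turn\<close> record ascents and descents around
    the polygon.\<close>
  define x where "x i = cross2 (V i) (orient *\<^sub>R e)" for i
  have x_Suc: "x (Suc i) = x i + turn i e" for i
    by (simp add: x_def turn_def edge_def cross2_linear algebra_simps)
  have "\<exists>r b. 0 < b \<and> b < m \<and> (\<forall>k<b. x (r + k) < x (Suc (r + k))) \<and>
    (\<forall>k. b \<le> k \<longrightarrow> k < m \<longrightarrow> x (Suc (r + k)) < x (r + k))"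
  proof (rule cyclic_unimodal[of x m])
    show "x (i + m) = x i" for i
      unfolding x_def using vertex_cong[of "i + m" i] by simp
    show "0 < m"
      using m_ge_3 by linarith
    show "x (Suc i) \<noteq> x i" for i
      using e[of i] by (simp add: x_Suc)
    fix i k assume "x (Suc i) < x i" "x (Suc i) < x (Suc (Suc i))" and k: "k mod m \<noteq> Suc i mod m"
    then have "0 < cross2 (V k - V (Suc i)) (orient *\<^sub>R e)"
      by (intro local_min_imp_global_min[OF _ _ k]) (simp_all add: x_def cross2_linear right_diff_distrib)
    then show "x (Suc i) < x k"
      by (simp add: x_def cross2_linear right_diff_distrib)
  qed
  then show ?thesis
    unfolding x_Suc by simp
qed

end

text \<open>A number that is real together with its product by \<i> is 0. Non-reality is needed
  because an \<alpha> equal to its conjugate would merge the two blocks into one.\<close>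

lemma ae_eq_real_cnj:
  assumes "ae_eq haar g (\<lambda>z. cnj (g z))" and "ae_eq haar (\<lambda>z. \<i> * g z) (\<lambda>z. cnj (\<i> * g z))"
    and "AE z in haar. g z \<noteq> 0"
  shows False
proof -
  have "AE z in haar. False"
    using assms unfolding ae_eq_def by eventually_elim (auto simp: complex_eq_iff)
  then have "emeasure haar (space haar) = 0"
    by (simp add: eventually_False ae_filter_eq_bot_iff)
  then show False
    by (simp add: emeasure_haar)
qed

text \<open>\<open>f\<close> is only essentially bounded, whereas \<open>analytic_modulus\<close>
  asks for bounds everywhere on the torus; truncation at an essential bound changes \<open>f\<close>
  on a null set only. Minimum with a constant and logarithm are increasing and continuous, so they
  respect lower semicontinuity.\<close>

lemma lower_semicontinuous_truncated_log:
  assumes f: "lower_semicontinuous_on S f" and pos: "\<forall>x\<in>S. 0 < f x" and B: "0 < B"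
  shows "lower_semicontinuous_on S (\<lambda>x. ln (min (f x) B) / 2)"
  unfolding lower_semicontinuous_on_def
proof (intro ballI allI impI)
  fix x c assume x: "x \<in> S" and c: "c < ln (min (f x) B) / 2"
  have iff: "c < ln (min (f y) B) / 2 \<longleftrightarrow> exp (2 * c) < f y \<and> exp (2 * c) < B" if "y \<in> S" for y
  proof -
    have "0 < min (f y) B"
      using pos that B by simp
    then have "2 * c < ln (min (f y) B) \<longleftrightarrow> exp (2 * c) < min (f y) B"
      by (metis exp_less_cancel_iff exp_ln)
    then show ?thesis
      by auto
  qed
  have c': "exp (2 * c) < f x" "exp (2 * c) < B"
    using c iff[OF x] by simp_all
  have "eventually (\<lambda>y. exp (2 * c) < f y) (at x within S)"
    using f x c'(1) unfolding lower_semicontinuous_on_def by blast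
  moreover have "eventually (\<lambda>y. y \<in> S) (at x within S)"
    by (simp add: eventually_at_filter)
  ultimately show "eventually (\<lambda>y. c < ln (min (f y) B) / 2) (at x within S)"
  proof eventually_elim
    case (elim y)
    then show ?case
      using iff[of y] c'(2) by blast
  qed
qed

lemma (in deep_cone) spectral_factor:
  assumes pos: "\<forall>z\<in>torus. 0 < f z" and bdd: "ess_bounded haar f" and lsc: "lower_semicontinuous_on torus f"
  obtains \<alpha> where "Linf_invertible haar \<alpha>" "Spec \<alpha> \<subseteq> P" "abs_square_factor f \<alpha>"
    and "\<not> ae_eq haar \<alpha> (\<lambda>z. cnj (\<alpha> z))"
proof -
  obtain c where c: "0 < c" "\<And>z. z \<in> torus \<Longrightarrow> c \<le> f z"
    using lower_semicontinuous_on_pos_lower_bound[OF lsc compact_torus pos] by blast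
  obtain B0 where B0: "AE z in haar. norm (f z) \<le> B0"
    using bdd unfolding ess_bounded_def by blast
  \<comment> \<open>The maximum with \<open>c\<close> keeps the truncated function above
    \<open>c\<close>, hence its logarithm above ln c.\<close>
  define B where "B = max B0 c"
  have B: "0 < B" "c \<le> B"
    using c(1) by (simp_all add: B_def)
  define h where "h z = ln (min (f z) B) / 2" for z
  have "lower_semicontinuous_on torus h"
    unfolding h_def by (rule lower_semicontinuous_truncated_log[OF lsc pos B(1)])
  moreover have h_ge: "ln c / 2 \<le> h z" if "z \<in> torus" for z
    unfolding h_def using c(1) c(2)[OF that] B by simp
  moreover have "h z \<le> ln B / 2" if "z \<in> torus" for z
    unfolding h_def using c(1) c(2)[OF that] B by simp
  ultimately obtain g where g: "g \<in> Linf haar" "Spec g \<subseteq> P" "AE z in haar. norm (g z) = exp (h z)"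
    by (rule analytic_modulus)
  have g_ne: "AE z in haar. g z \<noteq> 0"
    using g(3)
  proof eventually_elim
    case (elim z)
    then show ?case
      by (metis exp_not_eq_zero norm_zero)
  qed
  \<comment> \<open>A unimodular constant preserves the modulus and adds no frequencies.\<close>
  have "\<exists>c. norm c = 1 \<and> \<not> ae_eq haar (\<lambda>z. c * g z) (\<lambda>z. cnj (c * g z))"
  proof (cases "ae_eq haar g (\<lambda>z. cnj (g z))")
    case True
    then show ?thesis
      using ae_eq_real_cnj[OF True _ g_ne] by (intro exI[of _ \<i>]) auto
  next
    case False
    then show ?thesis
      by (intro exI[of _ 1]) simp
  qed
  then obtain \<zeta> where \<zeta>: "norm \<zeta> = 1" and not_real: "\<not> ae_eq haar (\<lambda>z. \<zeta> * g z) (\<lambda>z. cnj (\<zeta> * g z))"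
    by blast
  define \<alpha> where "\<alpha> z = \<zeta> * g z" for z
  have \<alpha>_Linf: "\<alpha> \<in> Linf haar"
    unfolding \<alpha>_def by (intro Linf_mult Linf_const g)
  have norm_\<alpha>: "AE z in haar. norm (\<alpha> z) = exp (h z)"
    using g(3) by eventually_elim (simp add: \<alpha>_def norm_mult \<zeta>)
  show ?thesis
  proof (rule that)
    have "(\<lambda>z. inverse (\<alpha> z)) \<in> Linf haar"
    proof (rule LinfI)
      show "(\<lambda>z. inverse (\<alpha> z)) \<in> borel_measurable haar"
        using Linf_measurable[OF \<alpha>_Linf] by (rule borel_measurable_inverse)
      show "AE z in haar. norm (inverse (\<alpha> z)) \<le> exp (- (ln c / 2))"
        using norm_\<alpha> AE_space
      proof eventually_elim
        case (elim z)
        then show ?case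
          using h_ge[of z] by (simp add: norm_inverse flip: exp_minus)
      qed
    qed
    moreover have "AE z in haar. \<alpha> z \<noteq> 0"
      using norm_\<alpha>
    proof eventually_elim
      case (elim z)
      then show ?case
        by (metis exp_not_eq_zero norm_zero)
    qed
    ultimately show "Linf_invertible haar \<alpha>"
      using \<alpha>_Linf by (simp add: Linf_invertible_def)
    show "Spec \<alpha> \<subseteq> P"
      unfolding \<alpha>_def using Spec_cmult g(2) by (rule order_trans)
    show "abs_square_factor f \<alpha>"
      unfolding abs_square_factor_def ae_eq_def
      using norm_\<alpha> B0 AE_space
    proof eventually_elim
      case (elim z)
      then have z: "z \<in> torus" by simp
      have "min (f z) B = f z"
        using elim(2) by (simp add: B_def min_absorb1 le_max_iff_disj abs_le_iff)
      then have "2 * h z = ln (f z)"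
        by (simp add: h_def)
      then have "(norm (\<alpha> z))\<^sup>2 = f z"
        using elim(1) bspec[OF pos z] by (simp flip: exp_double)
      then show ?case
        using complex_norm_square[of "\<alpha> z"] by simp
    qed
    show "\<not> ae_eq haar \<alpha> (\<lambda>z. cnj (\<alpha> z))"
      unfolding \<alpha>_def by (rule not_real)
  qed
qed

section \<open>Assembling the factorization\<close>

lemma abs_square_factor_cnj: "abs_square_factor f g \<Longrightarrow> abs_square_factor f (\<lambda>z. cnj (g z))"
  by (simp add: abs_square_factor_def mult.commute)

lemma Linf_invertible_cnj: "Linf_invertible haar g \<Longrightarrow> Linf_invertible haar (\<lambda>z. cnj (g z))"
  using Linf_cnj[of g] Linf_cnj[of "\<lambda>z. inverse (g z)"] by (simp add: Linf_invertible_def)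

lemma ae_eq_refl: "ae_eq M g g"
  by (simp add: ae_eq_def)

lemma ae_eq_sym: "ae_eq M g h \<Longrightarrow> ae_eq M h g"
  by (simp add: ae_eq_def eq_commute)

theorem proposition2:
  fixes f :: "complex \<times> complex \<Rightarrow> real" and As :: "(nat \<times> nat) list" and j :: nat
  assumes "\<forall>z\<in>torus. 0 < f z"
    and "ess_bounded haar f"
    and "lower_semicontinuous_on torus f"
    and "convex_polygon As"
    and "j < length As"
  shows "\<exists>C. two_sided_cone C \<and> C \<subseteq> vertex_cone0 As j \<and>
           (\<exists>Gs gs. associated_factorization As j C f Gs \<and>
              issued_factorization Gs gs \<and> minimal_factorization gs)"
proof -
  interpret polygon_vertices As
    by standard (rule assms(4))
  obtain e where e_j: "0 < turn (j + m - 1) (lattice_pt e)" "0 < turn j (lattice_pt e)"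
    and e: "\<And>i. turn i (lattice_pt e) \<noteq> 0"
    using generic_direction[of j] by blast
  obtain Cp where Cp: "half_cone_of Cp (Cp \<union> uminus ` Cp)" and deep: "deep_cone (integer_points Cp)"
    and turn_Cp: "\<And>i y. y \<in> Cp \<Longrightarrow> 0 \<le> turn i (lattice_pt e) * turn i y"
    using thin_cone[OF e] by blast
  obtain \<alpha> where inv: "Linf_invertible haar \<alpha>" and spec: "Spec \<alpha> \<subseteq> integer_points Cp"
    and fac: "abs_square_factor f \<alpha>" and not_real: "\<not> ae_eq haar \<alpha> (\<lambda>z. cnj (\<alpha> z))"
    using deep_cone.spectral_factor[OF deep assms(1,2,3)] .
  obtain r b where b: "0 < b" "b < m" and up: "\<And>k. k < b \<Longrightarrow> 0 < turn (r + k) (lattice_pt e)"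
    and down: "\<And>k. b \<le> k \<Longrightarrow> k < m \<Longrightarrow> turn (r + k) (lattice_pt e) < 0"
    using turn_sign_change[OF e] by blast
  define \<alpha>' where "\<alpha>' = (\<lambda>z. cnj (\<alpha> z))"
  \<comment> \<open>By \<open>turn_Cp\<close> the sign at the single direction \<open>e\<close>
    decides for the whole of \<open>Cp\<close>.\<close>
  define Gs where "Gs = map (\<lambda>i. if 0 < turn i (lattice_pt e) then \<alpha> else \<alpha>') [0..<m]"
  have len: "length Gs = m"
    by (simp add: Gs_def)
  have Gs: "Gs ! i = (if 0 < turn i (lattice_pt e) then \<alpha> else \<alpha>')" if "i < m" for i
    using that by (simp add: Gs_def)
  have Cp_sub: "Cp \<subseteq> vertex_half_cone0 As j"
    unfolding vertex_half_cone0_eq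
  proof (intro subsetI CollectI conjI)
    fix y assume y: "y \<in> Cp"
    show "0 \<le> turn (j + m - 1) y"
      using turn_Cp[OF y, of "j + m - 1"] e_j(1) by (simp add: zero_le_mult_iff)
    show "0 \<le> turn j y"
      using turn_Cp[OF y, of j] e_j(2) by (simp add: zero_le_mult_iff)
  qed
  have C_sub: "Cp \<union> uminus ` Cp \<subseteq> vertex_cone0 As j"
    unfolding vertex_cone0_def using Cp_sub by blast
  have side: "abs_square_factor f (Gs ! i) \<and> Linf_invertible haar (Gs ! i) \<and>
      Spec (Gs ! i) \<subseteq> side_points0 As i \<and> (ae_eq haar (Gs ! i) \<alpha> \<or> ae_eq haar (Gs ! i) (\<lambda>z. cnj (\<alpha> z)))"
    if i: "i < m" for i
  proof (cases "0 < turn i (lattice_pt e)")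
    case True
    have "k \<in> side_points0 As i" if "k \<in> Spec \<alpha>" for k
    proof -
      have "lattice_pt k \<in> Cp"
        using spec that by (auto simp: integer_points_def)
      from turn_Cp[OF this, of i] show ?thesis
        using True by (simp add: side_points0_eq zero_le_mult_iff)
    qed
    then show ?thesis
      using True inv fac by (auto simp: Gs[OF i] ae_eq_refl)
  next
    case False
    then have neg: "turn i (lattice_pt e) < 0"
      using e[of i] by simp
    have "k \<in> side_points0 As i" if "k \<in> Spec \<alpha>'" for k
    proof -
      have "- k \<in> Spec \<alpha>"
        using that unfolding \<alpha>'_def Spec_cnj by auto
      then have "lattice_pt (- k) \<in> Cp"
        using spec by (auto simp: integer_points_def)
      from turn_Cp[OF this, of i] show ?thesis
        using neg by (simp add: side_points0_eq lattice_pt_uminus turn_linear mult_le_0_iff)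
    qed
    then show ?thesis
      using False Linf_invertible_cnj[OF inv] abs_square_factor_cnj[OF fac]
      by (auto simp: Gs[OF i] \<alpha>'_def ae_eq_refl)
  qed
  have "\<alpha> \<in> Linf haar"
    using inv by (simp add: Linf_invertible_def)
  then have "associated_factorization As j (Cp \<union> uminus ` Cp) f Gs"
    unfolding associated_factorization_def
    using C_sub Cp Cp_sub fac spec len side by blast
  moreover have "issued_factorization Gs [\<alpha>, \<alpha>']"
    unfolding issued_factorization_def
  proof (intro conjI)
    have Gs_up: "Gs ! ((r + k) mod m) = \<alpha>" if "k < b" for k
      using up[OF that] by (simp add: Gs[OF mod_m_less] turn_mod)
    have Gs_down: "Gs ! ((r + k) mod m) = \<alpha>'" if "b \<le> k" "k < m" for k
      using down[OF that] by (simp add: Gs[OF mod_m_less] turn_mod)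
    \<comment> \<open>Block boundaries 0, b and m, counted after the rotation by
      \<open>r\<close>.\<close>
    let ?b = "\<lambda>i :: nat. if i = 0 then 0 else if i = 1 then b else m"
    show "\<exists>r b. b 0 = 0 \<and> b (length [\<alpha>, \<alpha>']) = length Gs \<and> (\<forall>j<length [\<alpha>, \<alpha>']. b j < b (Suc j) \<and>
        (\<forall>k\<in>{b j..<b (Suc j)}. ae_eq haar (Gs ! ((r + k) mod length Gs)) ([\<alpha>, \<alpha>'] ! j)))"
      using b Gs_up Gs_down
      by (intro exI[of _ r] exI[of _ ?b]) (auto simp: len less_Suc_eq ae_eq_refl)
    \<comment> \<open>With two blocks the cyclic condition compares the same pair in both
      orders.\<close>
    show "\<forall>j<length [\<alpha>, \<alpha>']. \<not> ae_eq haar ([\<alpha>, \<alpha>'] ! j) ([\<alpha>, \<alpha>'] ! (Suc j mod length [\<alpha>, \<alpha>']))"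
      using not_real ae_eq_sym[of haar \<alpha>' \<alpha>] by (auto simp: less_Suc_eq \<alpha>'_def)
  qed simp
  moreover have "minimal_factorization [\<alpha>, \<alpha>']"
    by (simp add: minimal_factorization_def)
  moreover have "two_sided_cone (Cp \<union> uminus ` Cp)"
    unfolding two_sided_cone_def using Cp by blast
  ultimately show ?thesis
    using C_sub by blast
qed

end
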